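(* Let $d, n \ge 1$ and let $\Omega = \{ x \in \mathbb{R}^d : g_1(x) \ge 0, \ldots, g_H(x) \ge 0 \}$ be a compact semialgebraic set with nonempty interior, where the $d$-variate real polynomials $g_1,\ldots,g_H$ satisfy the Archimedean condition. Let $f$ be a real $d$-variate polynomial of degree $N \ge n$. Put $n'_h := \lceil \deg(g_h)/2 \rceil$ for $h=1,\ldots,H$. Then, for integers $t \ge N + \max\{n'_1,\ldots,n'_H\}$, the values $$ \mathrm{ub}_t := \inf_{c \in \mathbb{R},\, p \in \mathcal{P}_{n-1}^d} \; c \quad \text{subject to } c + f - p \in \mathcal{Q}(g_1,\ldots,g_H)_t \text{ and } c - f + p \in \mathcal{Q}(g_1,\ldots,g_H)_t $$ and $$ \mathrm{ub}'_t := \sup_{y^+,\, y^-} \; \sum_{|\ell| \le N} \mathrm{coeff}_{m_\ell}(f)\, (y^+_\ell - y^-_\ell), $$ where the supremum is over pairs $y^+ , y^-$ of finite real sequences indexed by $\{\ell \in \mathbb{N}_0^d : |\ell| \le 2t\}$ satisfying $y^+_\ell - y^-_\ell = 0$ for all $|\ell| \le n-1$, $y^+_0 + y^-_0 = 1$, and $$ \mathrm{Hank}_t(y^{\pm}) \succeq 0, \quad \mathrm{Hank}_{t-n'_1}(G_1 y^{\pm}) \succeq 0, \; \ldots, \; \mathrm{Hank}_{t-n'_H}(G_H y^{\pm}) \succeq 0, $$ form nonincreasing sequences (in $t$) of upper bounds for the error $E_{\mathcal{P}_{n-1}^d}(f,\Omega)$ of best approximation to $f$ from $\mathcal{P}_{n-1}^d$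 relative to $\Omega$. Moreover, these sequences converge to the error of best approximation, i.e., $$ \lim_{t \to \infty} \mathrm{ub}_t = \lim_{t \to \infty} \mathrm{ub}'_t = E_{\mathcal{P}_{n-1}^d}(f,\Omega). $$
   Context: $\mathcal{P}_n^d$ denotes the space of real polynomials in $d$ variables of total degree at most $n$; $m_\ell(x) = x_1^{\ell_1}\cdots x_d^{\ell_d}$ and $|\ell| = \ell_1 + \cdots + \ell_d$ for $\ell \in \mathbb{N}_0^d$, with $\mathbb{N}_0=\{0,1,2,\ldots\}$; $\mathrm{coeff}_{m_\ell}(f)$ is the coefficient of $f$ on the monomial $m_\ell$. The error of best approximation is $E_{\mathcal{P}_{n-1}^d}(f,\Omega) = \min_{p \in \mathcal{P}_{n-1}^d} \max_{x \in \Omega} |f(x) - p(x)|$. Archimedean condition: there exist a constant $C > 0$ and sum-of-squares polynomials $\sigma_0,\sigma_1,\ldots,\sigma_H$ such that $C - \|x\|_2^2 = \sigma_0(x) + \sum_{h=1}^H \sigma_h(x) g_h(x)$ as polynomials in $x$. Truncated quadratic module: $\mathcal{Q}(g_1,\ldots,g_H)_t$ is the set of polynomials of the form $\sigma_0 + \sigma_1 g_1 + \cdots + \sigma_H g_H$ where $\sigma_0,\ldots,\sigma_H$ are sum-of-squares polynomials with $\deg(\sigma_0) \le 2t$ and $\deg(\sigma_h g_h) \le 2t$ for $h=1,\ldots,H$. Hankel matrices: for a sequence $y$ indexed by multiindices, $\mathrm{Hank}_t(y)$ is the $\binom{t+d}{d} \times \binom{t+d}{d}$ matrix with rows and columns indexed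 by $i,j \in \mathbb{N}_0^d$ with $|i|,|j| \le t$ and with entries $y_{i+j}$. The sequence $G_h y$ is defined by $(G_h y)_\ell = \sum_{|\ell'| \le \deg(g_h)} \mathrm{coeff}_{m_{\ell'}}(g_h)\, y_{\ell + \ell'}$. The notation $\succeq 0$ means positive semidefinite, and a condition written with $y^{\pm}$ is imposed on both $y^+$ and $y^-$. The values $\mathrm{ub}_t, \mathrm{ub}'_t$ are understood as extended real numbers: if the program defining $\mathrm{ub}_t$ is infeasible, then $\mathrm{ub}_t = +\infty$ (which may happen only for small $t$), and $\mathrm{ub}'_t = +\infty$ if its program is unbounded. *)

theory Defs
  imports "HOL-Analysis.Analysis" "HOL-Library.Poly_Mapping"
begin

text \<open>A multi-index is a vector of type \<^typ>\<open>nat ^ 'd\<close>, and a real polynomial in the variables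
  indexed by \<open>'d\<close> is a finitely supported map from multi-indices to coefficients, multiplied by
  convolution; the coefficient of \<open>p\<close> on the monomial \<open>x ^ l\<close> is \<open>lookup p l\<close>.\<close>

type_synonym 'd mpoly = "(nat ^ 'd) \<Rightarrow>\<^sub>0 real"

definition mdeg :: "nat ^ 'd::finite \<Rightarrow> nat" where
  "mdeg l = (\<Sum>i\<in>UNIV. l $ i)"

definition monom_val :: "nat ^ 'd::finite \<Rightarrow> real ^ 'd \<Rightarrow> real" where
  "monom_val l x = (\<Prod>i\<in>UNIV. x $ i ^ (l $ i))"

definition peval :: "'d::finite mpoly \<Rightarrow> real ^ 'd \<Rightarrow> real" where
  "peval p x = (\<Sum>l\<in>Poly_Mapping.keys p. Poly_Mapping.lookup p l * monom_val l x)"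

text \<open>The total degree; the zero polynomial gets degree 0, so that it belongs to every
  \<open>polys_upto n\<close>.\<close>

definition tdeg :: "'d::finite mpoly \<Rightarrow> nat" where
  "tdeg p = Max (insert 0 (mdeg ` Poly_Mapping.keys p))"

definition polys_upto :: "nat \<Rightarrow> 'd::finite mpoly set" where
  "polys_upto n = {p. tdeg p \<le> n}"

definition const_poly :: "real \<Rightarrow> 'd::finite mpoly" where
  "const_poly c = Poly_Mapping.single 0 c"

definition var_poly :: "'d::finite \<Rightarrow> 'd mpoly" where
  "var_poly i = Poly_Mapping.single (axis i 1) 1"

definition sos :: "'d::finite mpoly \<Rightarrow> bool" where
  "sos \<sigma> \<longleftrightarrow> (\<exists>(k::nat) q. \<sigma> = (\<Sum>i<k. (q i)\<^sup>2))"

text \<open>In what follows the constraint polynomials are \<open>g 1, \<dots>, g H\<close>; values of \<open>g\<close> at other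
  indices are never used.\<close>

definition semialg_set :: "nat \<Rightarrow> (nat \<Rightarrow> 'd::finite mpoly) \<Rightarrow> (real ^ 'd) set" where
  "semialg_set H g = {x. \<forall>h\<in>{1..H}. peval (g h) x \<ge> 0}"

definition archimedean :: "nat \<Rightarrow> (nat \<Rightarrow> 'd::finite mpoly) \<Rightarrow> bool" where
  "archimedean H g \<longleftrightarrow>
     (\<exists>C \<sigma>. C > 0 \<and> (\<forall>h\<in>{0..H}. sos (\<sigma> h)) \<and>
        const_poly C - (\<Sum>i\<in>UNIV. (var_poly i)\<^sup>2) = \<sigma> 0 + (\<Sum>h=1..H. \<sigma> h * g h))"

definition quad_module :: "nat \<Rightarrow> (nat \<Rightarrow> 'd::finite mpoly) \<Rightarrow> nat \<Rightarrow> 'd mpoly set" where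
  "quad_module H g t =
     {\<sigma> 0 + (\<Sum>h=1..H. \<sigma> h * g h) | \<sigma>.
        (\<forall>h\<in>{0..H}. sos (\<sigma> h)) \<and>
        tdeg (\<sigma> 0) \<le> 2 * t \<and> (\<forall>h\<in>{1..H}. tdeg (\<sigma> h * g h) \<le> 2 * t)}"

definition half_deg :: "'d::finite mpoly \<Rightarrow> nat" where
  "half_deg p = nat \<lceil>real (tdeg p) / 2\<rceil>"

text \<open>The error of best approximation is a minimum (over \<open>p\<close>) of maxima (over \<open>x \<in> \<Omega>\<close>), written
  literally as least and greatest elements of the sets of values.\<close>

definition max_dist :: "'d::finite mpoly \<Rightarrow> 'd mpoly \<Rightarrow> (real ^ 'd) set \<Rightarrow> real" where
  "max_dist f p \<Omega> = (GREATEST v. v \<in> (\<lambda>x. \<bar>peval f x - peval p x\<bar>) ` \<Omega>)"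

definition best_approx_error :: "nat \<Rightarrow> 'd::finite mpoly \<Rightarrow> (real ^ 'd) set \<Rightarrow> real" where
  "best_approx_error m f \<Omega> = (LEAST e. e \<in> (\<lambda>p. max_dist f p \<Omega>) ` polys_upto m)"

text \<open>Matrices have entries indexed by multi-indices; \<open>psd_on I A\<close> says that the finite
  matrix with rows and columns in \<open>I\<close> is positive semidefinite.\<close>

definition psd_on :: "'i set \<Rightarrow> ('i \<Rightarrow> 'i \<Rightarrow> real) \<Rightarrow> bool" where
  "psd_on I A \<longleftrightarrow>
     (\<forall>i\<in>I. \<forall>j\<in>I. A i j = A j i) \<and>
     (\<forall>v. 0 \<le> (\<Sum>i\<in>I. \<Sum>j\<in>I. v i * A i j * v j))"

definition hankel :: "(nat ^ 'd::finite \<Rightarrow> real) \<Rightarrow> nat ^ 'd \<Rightarrow> nat ^ 'd \<Rightarrow> real" where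
  "hankel y i j = y (i + j)"

definition hankel_psd :: "nat \<Rightarrow> (nat ^ 'd::finite \<Rightarrow> real) \<Rightarrow> bool" where
  "hankel_psd t y \<longleftrightarrow> psd_on {l. mdeg l \<le> t} (hankel y)"

definition shift_seq :: "'d::finite mpoly \<Rightarrow> (nat ^ 'd \<Rightarrow> real) \<Rightarrow> nat ^ 'd \<Rightarrow> real" where
  "shift_seq p y l = (\<Sum>l' | mdeg l' \<le> tdeg p. Poly_Mapping.lookup p l' * y (l + l'))"

text \<open>For \<open>half_deg (g h) \<le> t\<close>, all indices at which \<open>y\<close> is evaluated below have
  \<open>mdeg l \<le> 2 * t\<close>.\<close>

definition psd_constraints ::
    "nat \<Rightarrow> (nat \<Rightarrow> 'd::finite mpoly) \<Rightarrow> nat \<Rightarrow> (nat ^ 'd \<Rightarrow> real) \<Rightarrow> bool" where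
  "psd_constraints H g t y \<longleftrightarrow>
     hankel_psd t y \<and> (\<forall>h\<in>{1..H}. hankel_psd (t - half_deg (g h)) (shift_seq (g h) y))"

definition ub :: "nat \<Rightarrow> (nat \<Rightarrow> 'd::finite mpoly) \<Rightarrow> nat \<Rightarrow> 'd mpoly \<Rightarrow> nat \<Rightarrow> ereal" where
  "ub H g n f t =
     Inf {ereal c | c p. p \<in> polys_upto (n - 1) \<and>
            const_poly c + f - p \<in> quad_module H g t \<and>
            const_poly c - f + p \<in> quad_module H g t}"

text \<open>Finite sequences indexed by \<open>{l. mdeg l \<le> 2 * t}\<close> are modelled by \<open>\<rightarrow>\<^sub>E\<close>.\<close>

definition ub' :: "nat \<Rightarrow> (nat \<Rightarrow> 'd::finite mpoly) \<Rightarrow> nat \<Rightarrow> 'd mpoly \<Rightarrow> nat \<Rightarrow> ereal" where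
  "ub' H g n f t =
     Sup {ereal (\<Sum>l | mdeg l \<le> tdeg f. Poly_Mapping.lookup f l * (yp l - ym l)) | yp ym.
            yp \<in> {l. mdeg l \<le> 2 * t} \<rightarrow>\<^sub>E UNIV \<and> ym \<in> {l. mdeg l \<le> 2 * t} \<rightarrow>\<^sub>E UNIV \<and>
            (\<forall>l. mdeg l \<le> n - 1 \<longrightarrow> yp l - ym l = 0) \<and>
            yp 0 + ym 0 = 1 \<and>
            psd_constraints H g t yp \<and> psd_constraints H g t ym}"

end

theory Submission
  imports Defs
begin

text \<open>
  Let \<open>\<Omega>\<close> be the semialgebraic set and \<open>E\<close> the error of best approximation. The two programs
  are truncations of exact descriptions of \<open>E\<close>: \<open>E\<close> is the least \<open>c\<close> such that \<open>c \<plusminus> (f - p)\<close> are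
  nonnegative on \<open>\<Omega>\<close> for some \<open>p\<close>, and it is also the largest value of \<open>L\<^sup>+ f - L\<^sup>- f\<close> over pairs
  of functionals that are nonnegative on polynomials nonnegative on \<open>\<Omega>\<close>, that agree on low degrees
  and have total mass 1. The program \<open>ub\<close> replaces nonnegativity by membership in a truncated
  quadratic module, the program \<open>ub'\<close> demands nonnegativity of the functionals only on
  such certificates.

  That \<open>ub\<close> bounds \<open>E\<close> from above is immediate, since members of the quadratic module are
  nonnegative on \<open>\<Omega>\<close> (\<open>best_approx_error_le_ub\<close>). For \<open>ub'\<close> one needs an optimal pair of
  functionals (\<open>dual_functionals_exist\<close>). The condition that a finite table of values comes from
  such a pair is a domination condition by a supremum, so the pair is obtained from a Hahn-Banach
  extension; only the finitely many monomials of degree at most \<open>2 t\<close> matter, hence finitely many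
  one-dimensional extension steps suffice (\<open>dominated_extension\<close>).

  Convergence of both sequences comes from one certificate. If \<open>p\<close> is a best approximation, then
  \<open>E + \<epsilon> \<plusminus> (f - p)\<close> are positive on \<open>\<Omega>\<close>, so by Putinar's theorem (\<open>putinar\<close>) they lie in the
  quadratic module. A given certificate has some finite degree; from some \<open>t\<close> on it is admissible
  in \<open>ub\<close> and every feasible pair of sequences in \<open>ub'\<close> is nonnegative on it
  (\<open>qm_eventually\<close>), whence \<open>ub t \<le> E + \<epsilon>\<close> and \<open>ub' t \<le> E + \<epsilon>\<close>.

  Putinar's theorem is proved in two steps. On a box that contains \<open>\<Omega>\<close> and after scaling the
  constraints to be at most 1 there, subtracting a suitable multiple of
  \<open>\<Sum>h. (1 - g h)\<^sup>2\<^sup>k g h\<close> makes \<open>f\<close> positive on the whole box while changing it by an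
  element of the quadratic module (\<open>exists_positive_penalized\<close>). A polynomial positive on the box
  has positive Bernstein coefficients for large degree, and the Bernstein basis consists of
  products of the linear forms \<open>R \<plusminus> x\<^sub>i\<close>; these lie in the quadratic module of \<open>R\<^sup>2 - \<parallel>x\<parallel>\<^sup>2\<close>, which
  has a single generator and is therefore closed under multiplication
  (\<open>positive_on_box_in_ball_preorder\<close>).

  The minimum in the definition of \<open>E\<close> exists because best approximations from a finite-dimensional
  space exist (\<open>best_approximation_exists\<close>).
\<close>

section \<open>Polynomials as linear functionals and as functions\<close>

abbreviation "lookup \<equiv> Poly_Mapping.lookup"
abbreviation "keys \<equiv> Poly_Mapping.keys"

text \<open>The Riesz functional of the sequence \<open>y\<close>. Evaluation at a point is the case of the
  moments of a Dirac measure (\<open>peval_riesz\<close>), so evaluation inherits its algebraic laws.\<close>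

definition riesz :: "('i \<Rightarrow> real) \<Rightarrow> ('i \<Rightarrow>\<^sub>0 real) \<Rightarrow> real" where
  "riesz y p = (\<Sum>l\<in>keys p. lookup p l * y l)"

lemma riesz_superset:
  assumes "finite A" "keys p \<subseteq> A"
  shows "riesz y p = (\<Sum>l\<in>A. lookup p l * y l)"
  unfolding riesz_def
  by (rule sum.mono_neutral_left) (use assms in \<open>auto simp: in_keys_iff\<close>)

lemma riesz_add: "riesz y (p + q) = riesz y p + riesz y q"
proof -
  let ?A = "keys p \<union> keys q"
  have "riesz y (p + q) = (\<Sum>l\<in>?A. lookup (p + q) l * y l)"
    by (rule riesz_superset) (auto dest: set_mp[OF Poly_Mapping.keys_add])
  moreover have "riesz y p = (\<Sum>l\<in>?A. lookup p l * y l)" by (rule riesz_superset) auto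
  moreover have "riesz y q = (\<Sum>l\<in>?A. lookup q l * y l)" by (rule riesz_superset) auto
  ultimately show ?thesis by (simp add: lookup_add algebra_simps sum.distrib)
qed

lemma riesz_zero [simp]: "riesz y 0 = 0"
  by (simp add: riesz_def)

lemma riesz_uminus: "riesz y (- p) = - riesz y p"
  using riesz_add[of y p "- p"] by simp

lemma riesz_diff: "riesz y (p - q) = riesz y p - riesz y q"
  using riesz_add[of y p "- q"] by (simp add: riesz_uminus)

lemma riesz_sum: "riesz y (\<Sum>i\<in>I. p i) = (\<Sum>i\<in>I. riesz y (p i))"
  by (induction I rule: infinite_finite_induct) (auto simp: riesz_add)

lemma riesz_single [simp]: "riesz y (Poly_Mapping.single l c) = c * y l"
  by (simp add: riesz_def)

lemma sum_single_superset:
  assumes "finite A" "keys p \<subseteq> A"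
  shows "p = (\<Sum>l\<in>A. Poly_Mapping.single l (lookup p l))"
proof (rule poly_mapping_eqI)
  fix k
  have "lookup (\<Sum>l\<in>A. Poly_Mapping.single l (lookup p l)) k = (\<Sum>l\<in>A. if l = k then lookup p k else 0)"
    unfolding lookup_sum by (rule sum.cong) (auto simp: lookup_single when_def)
  also have "\<dots> = lookup p k"
    using assms by (auto simp: in_keys_iff)
  finally show "lookup p k = lookup (\<Sum>l\<in>A. Poly_Mapping.single l (lookup p l)) k" by simp
qed

text \<open>This is the only place where the convolution product is unfolded. It says both
  that evaluation is multiplicative and that \<open>riesz y (q * q)\<close> is the quadratic form of the
  Hankel matrix of \<open>y\<close>.\<close>

lemma riesz_mult:
  fixes p q :: "('i::comm_monoid_add) \<Rightarrow>\<^sub>0 real"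
  assumes "finite A" "keys p \<subseteq> A" "finite B" "keys q \<subseteq> B"
  shows "riesz y (p * q) = (\<Sum>i\<in>A. \<Sum>j\<in>B. lookup p i * lookup q j * y (i + j))"
proof -
  have "p * q = (\<Sum>i\<in>A. \<Sum>j\<in>B. Poly_Mapping.single (i + j) (lookup p i * lookup q j))"
    by (subst sum_single_superset[OF assms(1,2)], subst sum_single_superset[OF assms(3,4)])
       (simp add: sum_product mult_single)
  then show ?thesis by (simp add: riesz_sum)
qed

lemma peval_riesz: "peval p x = riesz (\<lambda>l. monom_val l x) p"
  by (simp add: peval_def riesz_def)

lemma monom_val_0 [simp]: "monom_val 0 x = 1"
  by (simp add: monom_val_def)

lemma monom_val_add: "monom_val (k + l) x = monom_val k x * monom_val l x"
  by (simp add: monom_val_def power_add prod.distrib)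

lemma peval_add [simp]: "peval (p + q) x = peval p x + peval q x"
  and peval_diff [simp]: "peval (p - q) x = peval p x - peval q x"
  and peval_uminus [simp]: "peval (- p) x = - peval p x"
  and peval_zero [simp]: "peval 0 x = 0"
  and peval_sum: "peval (\<Sum>i\<in>I. r i) x = (\<Sum>i\<in>I. peval (r i) x)"
  and peval_single: "peval (Poly_Mapping.single l c) x = c * monom_val l x"
  by (simp_all add: peval_riesz riesz_add riesz_diff riesz_uminus riesz_sum)

lemma peval_mult [simp]: "peval (p * q) x = peval p x * peval q x"
proof -
  have "peval (p * q) x = (\<Sum>i\<in>keys p. \<Sum>j\<in>keys q. lookup p i * lookup q j * monom_val (i + j) x)"
    unfolding peval_riesz by (rule riesz_mult) auto
  also have "\<dots> = peval p x * peval q x"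
    by (simp add: peval_def sum_product monom_val_add mult_ac)
  finally show ?thesis .
qed

lemma peval_const [simp]: "peval (const_poly c) x = c"
  by (simp add: const_poly_def peval_single)

lemma const_poly_add: "const_poly (a + b) = const_poly a + const_poly b"
  and const_poly_mult: "const_poly (a * b) = const_poly a * const_poly b"
  and const_poly_0 [simp]: "const_poly 0 = 0"
  and const_poly_1 [simp]: "const_poly 1 = 1"
  by (simp_all add: const_poly_def single_add mult_single)

lemma const_poly_uminus: "const_poly (- a) = - const_poly a"
  by (simp add: const_poly_def single_uminus)

lemma const_poly_prod: "const_poly (\<Prod>i\<in>I. a i) = (\<Prod>i\<in>I. const_poly (a i))"
  by (induction I rule: infinite_finite_induct) (auto simp: const_poly_mult)

lemma const_poly_power: "const_poly (a ^ k) = const_poly a ^ k"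
  by (induction k) (auto simp: const_poly_mult)

lemma peval_one [simp]: "peval 1 x = 1"
  using peval_const[of 1 x] by simp

lemma peval_prod: "peval (\<Prod>i\<in>I. r i) x = (\<Prod>i\<in>I. peval (r i) x)"
  by (induction I rule: infinite_finite_induct) auto

lemma peval_power [simp]: "peval (p ^ k) x = peval p x ^ k"
  by (induction k) auto

lemma monom_val_axis [simp]: "monom_val (axis i (Suc 0)) x = x $ i"
proof -
  have "monom_val (axis i (Suc 0)) x = (\<Prod>j\<in>UNIV. if j = i then x $ i else 1)"
    unfolding monom_val_def by (rule prod.cong) (auto simp: axis_def)
  then show ?thesis by simp
qed

lemma peval_var [simp]: "peval (var_poly i) x = x $ i"
  by (simp add: var_poly_def peval_single)

lemma var_poly_power: "var_poly i ^ k = Poly_Mapping.single (axis i k) 1"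
proof (induction k)
  case 0
  have "axis i (0::nat) = 0" by (simp add: vec_eq_iff axis_def)
  then show ?case by (simp del: axis_eq_0_iff)
next
  case (Suc k)
  have "axis i 1 + axis i k = axis i (Suc k)" by (simp add: vec_eq_iff axis_def)
  with Suc show ?case by (simp add: var_poly_def mult_single)
qed

lemma prod_single: "finite I \<Longrightarrow>
  (\<Prod>i\<in>I. Poly_Mapping.single (a i) (1::real)) = Poly_Mapping.single (\<Sum>i\<in>I. a i) 1"
  for a :: "_ \<Rightarrow> ('b::comm_monoid_add)"
  by (induction I rule: finite_induct) (auto simp: mult_single)

lemma single_eq_prod_var:
  "Poly_Mapping.single l c = const_poly c * (\<Prod>i\<in>UNIV. var_poly i ^ (l $ i))"
  for l :: "nat ^ 'd::finite"
proof -
  have "(\<Sum>i\<in>UNIV. axis i (l $ i)) = l"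
    by (simp add: vec_eq_iff axis_def sum.If_cases)
  then show ?thesis
    by (simp add: var_poly_power prod_single const_poly_def mult_single)
qed

lemma continuous_on_peval: "continuous_on S (peval p)"
  unfolding peval_def[abs_def] monom_val_def by (intro continuous_intros)

lemma finite_mdeg_le [simp]: "finite {l :: nat ^ 'd::finite. mdeg l \<le> t}"
proof (rule finite_subset)
  show "{l :: nat ^ 'd. mdeg l \<le> t} \<subseteq> vec_lambda ` (PiE UNIV (\<lambda>_. {..t}))"
  proof
    fix l :: "nat ^ 'd" assume "l \<in> {l. mdeg l \<le> t}"
    then have "l $ i \<le> t" for i
      using member_le_sum[of i UNIV "\<lambda>i. l $ i"] by (auto simp: mdeg_def)
    then show "l \<in> vec_lambda ` (PiE UNIV (\<lambda>_. {..t}))"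
      by (intro image_eqI[of _ _ "vec_nth l"]) auto
  qed
qed (auto intro!: finite_imageI finite_PiE)

lemma mdeg_add: "mdeg (k + l) = mdeg k + mdeg l"
  by (simp add: mdeg_def sum.distrib)

lemma mdeg_0 [simp]: "mdeg 0 = 0"
  by (simp add: mdeg_def)

lemma tdeg_le_iff: "tdeg p \<le> n \<longleftrightarrow> keys p \<subseteq> {l. mdeg l \<le> n}"
  unfolding tdeg_def by (subst Max_le_iff) auto

lemma keys_subset_tdeg: "keys p \<subseteq> {l. mdeg l \<le> tdeg p}"
  using tdeg_le_iff by blast

lemma tdeg_mult: "tdeg (p * q) \<le> tdeg p + tdeg q"
  unfolding tdeg_le_iff
proof
  fix l assume "l \<in> keys (p * q)"
  then obtain a b where "a \<in> keys p" "b \<in> keys q" "l = a + b"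
    using Poly_Mapping.keys_mult by fast
  then show "l \<in> {l. mdeg l \<le> tdeg p + tdeg q}"
    using keys_subset_tdeg[of p] keys_subset_tdeg[of q] by (force simp: mdeg_add)
qed

lemma tdeg_le_half_deg: "tdeg p \<le> 2 * half_deg p"
  unfolding half_deg_def by linarith

lemma tdeg_uminus [simp]: "tdeg (- p) = tdeg p"
  by (simp add: tdeg_def keys_def)

lemma tdeg_const_poly [simp]: "tdeg (const_poly a) = 0"
proof -
  have "tdeg (const_poly a) \<le> 0"
    unfolding tdeg_le_iff const_poly_def by (auto split: if_splits)
  then show ?thesis by simp
qed

section \<open>Sums of squares and quadratic modules\<close>

lemma sos_square: "sos (q\<^sup>2)"
  unfolding sos_def by (rule exI[of _ 1], rule exI[of _ "\<lambda>_. q"]) simp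

lemma sos_add:
  assumes "sos a" "sos b" shows "sos (a + b)"
proof -
  obtain k q where a: "a = (\<Sum>i<(k::nat). (q i)\<^sup>2)" using assms sos_def by metis
  obtain m r where b: "b = (\<Sum>i<(m::nat). (r i)\<^sup>2)" using assms sos_def by metis
  let ?s = "\<lambda>i. if i < k then q i else r (i - k)"
  have "(\<Sum>i<k+m. (?s i)\<^sup>2) = (\<Sum>i<k. (?s i)\<^sup>2) + (\<Sum>i=k..<k+m. (?s i)\<^sup>2)"
    unfolding lessThan_atLeast0 by (rule sum.atLeastLessThan_concat[symmetric]) auto
  also have "(\<Sum>i=k..<k+m. (?s i)\<^sup>2) = b"
    unfolding b by (rule sum.reindex_bij_witness[of _ "\<lambda>i. i + k" "\<lambda>i. i - k"]) auto
  finally have "a + b = (\<Sum>i<k+m. (?s i)\<^sup>2)" by (simp add: a)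
  then show ?thesis unfolding sos_def by (intro exI)
qed

lemma sos_zero [simp]: "sos 0"
  using sos_square[of 0] by simp

lemma sos_sum: "(\<And>i. i \<in> I \<Longrightarrow> sos (a i)) \<Longrightarrow> sos (\<Sum>i\<in>I. a i)"
  by (induction I rule: infinite_finite_induct) (auto intro: sos_add)

lemma sos_mult:
  assumes "sos a" "sos b" shows "sos (a * b)"
proof -
  obtain k q where a: "a = (\<Sum>i<(k::nat). (q i)\<^sup>2)" using assms sos_def by metis
  obtain m r where b: "b = (\<Sum>i<(m::nat). (r i)\<^sup>2)" using assms sos_def by metis
  show ?thesis unfolding a b sum_product
    by (intro sos_sum) (metis sos_square power_mult_distrib)
qed

lemma sos_const: "c \<ge> 0 \<Longrightarrow> sos (const_poly c)"
  using sos_square[of "const_poly (sqrt c)"] by (simp flip: const_poly_power)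

lemma sos_1 [simp]: "sos 1"
  using sos_square[of 1] by simp

lemma sos_nonneg: "sos a \<Longrightarrow> peval a x \<ge> 0"
  unfolding sos_def by (auto simp: peval_sum intro!: sum_nonneg)

text \<open>The union of the truncated quadratic modules.\<close>

definition qm :: "nat \<Rightarrow> (nat \<Rightarrow> 'd::finite mpoly) \<Rightarrow> 'd mpoly set" where
  "qm H g = {\<sigma> 0 + (\<Sum>h=1..H. \<sigma> h * g h) | \<sigma>. \<forall>h\<in>{0..H}. sos (\<sigma> h)}"

lemma qmI: "(\<And>h. h \<in> {0..H} \<Longrightarrow> sos (\<sigma> h)) \<Longrightarrow> \<sigma> 0 + (\<Sum>h=1..H. \<sigma> h * g h) \<in> qm H g"
  unfolding qm_def by blast

lemma qm_add: 
  assumes "a \<in> qm H g" "b \<in> qm H g" shows "a + b \<in> qm H g"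
proof -
  from assms obtain s r where
    "a = s 0 + (\<Sum>h=1..H. s h * g h)" "\<forall>h\<in>{0..H}. sos (s h)" 
    "b = r 0 + (\<Sum>h=1..H. r h * g h)" "\<forall>h\<in>{0..H}. sos (r h)"
    unfolding qm_def by blast
  then show ?thesis
    using qmI[of H "\<lambda>h. s h + r h" g] by (simp add: sos_add algebra_simps sum.distrib)
qed

lemma qm_sos_mult:
  assumes "sos s" "a \<in> qm H g" shows "s * a \<in> qm H g"
proof -
  from assms obtain r where
    "a = r 0 + (\<Sum>h=1..H. r h * g h)" "\<forall>h\<in>{0..H}. sos (r h)" 
    unfolding qm_def by blast
  then show ?thesis
    using qmI[of H "\<lambda>h. s * r h" g] assms(1) by (simp add: sos_mult algebra_simps sum_distrib_left)
qed

lemma sos_in_qm: "sos s \<Longrightarrow> s \<in> qm H g"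
  using qmI[of H "\<lambda>h. if h = 0 then s else 0" g] by simp

text \<open>The quadratic module of the single polynomial \<open>C - \<parallel>x\<parallel>\<^sup>2\<close>, which describes a ball. In a product
  of two elements the only new term is the square of the generator times a sum of squares,
  which is again a sum of squares; hence, unlike a general quadratic
  module, this one is closed under multiplication (\<open>ball_preorder_mult\<close>).\<close>

definition ball_preorder :: "real \<Rightarrow> 'd::finite mpoly set" where
  "ball_preorder C = {a + b * (const_poly C - (\<Sum>i\<in>UNIV. (var_poly i)\<^sup>2)) | a b. sos a \<and> sos b}"

lemma ball_preorderI:
  "p = a + b * (const_poly C - (\<Sum>i\<in>UNIV. (var_poly i)\<^sup>2)) \<Longrightarrow> sos a \<Longrightarrow> sos b \<Longrightarrow> p \<in> ball_preorder C"
  unfolding ball_preorder_def by blast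

lemma ball_preorder_subset_qm:
  assumes "const_poly C - (\<Sum>i\<in>UNIV. (var_poly i)\<^sup>2) \<in> qm H g"
  shows "ball_preorder C \<subseteq> qm H g"
  unfolding ball_preorder_def using assms by (blast intro: qm_add qm_sos_mult sos_in_qm)

lemma ball_preorder_add:
  assumes "p \<in> ball_preorder C" "q \<in> ball_preorder C"
  shows "p + q \<in> ball_preorder C"
proof -
  let ?g = "const_poly C - (\<Sum>i\<in>UNIV. (var_poly i)\<^sup>2)"
  obtain a b a' b' where *: "p = a + b * ?g" "q = a' + b' * ?g" "sos a" "sos b" "sos a'" "sos b'"
    using assms unfolding ball_preorder_def by blast
  have "p + q = (a + a') + (b + b') * ?g"
    unfolding * by (simp add: algebra_simps)
  then show ?thesis using * sos_add unfolding ball_preorder_def by blast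
qed

lemma ball_preorder_mult:
  fixes p q :: "'d::finite mpoly"
  assumes "p \<in> ball_preorder C" "q \<in> ball_preorder C"
  shows "p * q \<in> ball_preorder C"
proof -
  define g :: "'d mpoly" where "g = const_poly C - (\<Sum>i\<in>UNIV. (var_poly i)\<^sup>2)"
  obtain a b a' b' where *: "p = a + b * g" "q = a' + b' * g" "sos a" "sos b" "sos a'" "sos b'"
    using assms unfolding ball_preorder_def g_def[symmetric] by blast
  have "p * q = (a * a' + b * b' * g\<^sup>2) + (a * b' + b * a') * g"
    unfolding * by (simp add: algebra_simps power2_eq_square)
  moreover have "sos (a * a' + b * b' * g\<^sup>2)" "sos (a * b' + b * a')"
    using * by (auto intro!: sos_add sos_mult sos_square)
  ultimately show ?thesis unfolding ball_preorder_def g_def by blast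
qed

lemma ball_preorder_sos: "sos a \<Longrightarrow> a \<in> ball_preorder C"
  for a :: "'d::finite mpoly"
  by (rule ball_preorderI[of _ a 0]) auto

lemma ball_preorder_sum: "(\<And>i. i \<in> I \<Longrightarrow> p i \<in> ball_preorder C) \<Longrightarrow> (\<Sum>i\<in>I. p i) \<in> ball_preorder C"
  by (induction I rule: infinite_finite_induct) (auto intro: ball_preorder_add ball_preorder_sos)

lemma ball_preorder_prod: "(\<And>i. i \<in> I \<Longrightarrow> p i \<in> ball_preorder C) \<Longrightarrow> (\<Prod>i\<in>I. p i) \<in> ball_preorder C"
  by (induction I rule: infinite_finite_induct) (auto intro: ball_preorder_mult ball_preorder_sos)

lemma ball_preorder_power: "p \<in> ball_preorder C \<Longrightarrow> p ^ k \<in> ball_preorder C"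
  by (induction k) (auto intro: ball_preorder_mult ball_preorder_sos)

text \<open>The certificate is \<open>2 R (R \<plusminus> x\<^sub>i) = (R \<plusminus> x\<^sub>i)\<^sup>2 + (\<Sum>j\<noteq>i. x\<^sub>j\<^sup>2) + (R\<^sup>2 - \<parallel>x\<parallel>\<^sup>2)\<close>.\<close>

lemma linear_in_ball_preorder:
  fixes i :: "'d::finite"
  assumes "R > 0" "s = var_poly i \<or> s = - var_poly i"
  shows "const_poly R + s \<in> ball_preorder (R\<^sup>2)"
proof -
  let ?x = "\<lambda>j. (var_poly j :: 'd mpoly)"
  let ?c = "const_poly (1 / (2 * R)) :: 'd mpoly"
  have s2: "s\<^sup>2 = (?x i)\<^sup>2" using assms(2) by auto
  have split: "(\<Sum>j\<in>UNIV. (?x j)\<^sup>2) = (?x i)\<^sup>2 + (\<Sum>j\<in>UNIV - {i}. (?x j)\<^sup>2)"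
    by (rule sum.remove) auto
  have half: "?c * (2 * const_poly R) = 1"
  proof -
    have "2 * const_poly R = (const_poly (2 * R) :: 'd mpoly)"
      unfolding mult_2 by (simp flip: const_poly_add)
    then show ?thesis using assms(1) by (simp flip: const_poly_mult)
  qed
  have eq: "(const_poly R + s)\<^sup>2 + (\<Sum>j\<in>UNIV - {i}. (?x j)\<^sup>2)
          + (const_poly (R\<^sup>2) - (\<Sum>j\<in>UNIV. (?x j)\<^sup>2)) = (2 * const_poly R) * (const_poly R + s)"
    unfolding split s2[symmetric] const_poly_power
    by (simp add: power2_eq_square algebra_simps)
  have "const_poly R + s = ?c * ((2 * const_poly R) * (const_poly R + s))"
    using half by (simp flip: mult.assoc)
  also have "\<dots> = ?c * ((const_poly R + s)\<^sup>2 + (\<Sum>j\<in>UNIV - {i}. (?x j)\<^sup>2))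
       + ?c * (const_poly (R\<^sup>2) - (\<Sum>j\<in>UNIV. (?x j)\<^sup>2))"
    unfolding eq[symmetric] by (rule distrib_left)
  finally show ?thesis
    using assms(1) by (rule_tac ball_preorderI) (auto intro!: sos_mult sos_add sos_sum sos_const sos_square)
qed

section \<open>Polynomials positive on a box\<close>

text \<open>The quotient of falling factorials \<open>k (k-1) \<dots> (k-l+1) / (m (m-1) \<dots> (m-l+1))\<close>, which is the
  coefficient of \<open>u\<^sup>l\<close> on the \<open>k\<close>-th Bernstein polynomial of degree \<open>m\<close>. It tends to \<open>(k/m)\<^sup>l\<close>, the value
  of \<open>u\<^sup>l\<close> at the corresponding node, uniformly in \<open>k\<close> (\<open>falling_ratio_bounds\<close>).\<close>

definition falling_ratio :: "nat \<Rightarrow> nat \<Rightarrow> nat \<Rightarrow> real" where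
  "falling_ratio m l k = (\<Prod>j<l. (real k - real j) / (real m - real j))"

lemma const_poly_of_nat: "const_poly (of_nat k) = of_nat k"
  by (induction k) (auto simp: const_poly_add)

text \<open>The case \<open>l = 0\<close> is the binomial theorem for \<open>(u + v)\<^sup>m = 1\<close>; multiplying the expansion of
  degree \<open>m - 1\<close> by \<open>u\<close> turns its \<open>k\<close>-th Bernstein polynomial into \<open>(k + 1) / m\<close> times the \<open>(k+1)\<close>-st
  one of degree \<open>m\<close>.\<close>

lemma power_bernstein_expansion:
  fixes u v :: "'d::finite mpoly"
  assumes uv: "u + v = 1" and "l \<le> m"
  shows "u ^ l = (\<Sum>k\<le>m. const_poly (falling_ratio m l k) *
                    (const_poly (real (m choose k)) * u ^ k * v ^ (m - k)))"
  using assms(2)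
proof (induction l arbitrary: m)
  case 0
  have "1 = (u + v) ^ m" by (simp add: uv)
  also have "\<dots> = (\<Sum>k\<le>m. of_nat (m choose k) * u ^ k * v ^ (m - k))" by (rule binomial_ring)
  finally show ?case by (simp add: falling_ratio_def const_poly_of_nat)
next
  case (Suc l)
  then obtain n where m: "m = Suc n" and ln: "l \<le> n" by (cases m) auto
  have coeff: "falling_ratio (Suc n) (Suc l) (Suc k) * real (Suc n choose Suc k)
      = falling_ratio n l k * real (n choose k)" for k
  proof -
    have "falling_ratio (Suc n) (Suc l) (Suc k) * real (Suc n choose Suc k)
        = falling_ratio n l k * (real (Suc k) * real (Suc n choose Suc k)) / real (Suc n)"
      unfolding falling_ratio_def prod.lessThan_Suc_shift by (simp del: binomial_Suc_Suc)
    also have "real (Suc k) * real (Suc n choose Suc k) = real (Suc n) * real (n choose k)"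
      unfolding of_nat_mult[symmetric] Suc_times_binomial_eq by (simp only: mult.commute)
    finally show ?thesis by simp
  qed
  have "u ^ Suc l = (\<Sum>k\<le>n. u * (const_poly (falling_ratio n l k) *
                    (const_poly (real (n choose k)) * u ^ k * v ^ (n - k))))"
    unfolding power_Suc Suc.IH[OF ln] by (rule sum_distrib_left)
  also have "\<dots> = (\<Sum>k\<le>n. const_poly (falling_ratio (Suc n) (Suc l) (Suc k)) *
      (const_poly (real (Suc n choose Suc k)) * u ^ Suc k * v ^ (Suc n - Suc k)))"
  proof (rule sum.cong[OF refl])
    fix k
    have "u * (const_poly (falling_ratio n l k) * (const_poly (real (n choose k)) * u ^ k * v ^ (n - k)))
      = const_poly (falling_ratio n l k * real (n choose k)) * u ^ Suc k * v ^ (n - k)"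
      by (simp add: const_poly_mult mult_ac)
    then show "u * (const_poly (falling_ratio n l k) * (const_poly (real (n choose k)) * u ^ k * v ^ (n - k)))
      = const_poly (falling_ratio (Suc n) (Suc l) (Suc k)) *
      (const_poly (real (Suc n choose Suc k)) * u ^ Suc k * v ^ (Suc n - Suc k))"
      unfolding coeff[symmetric] by (simp add: const_poly_mult mult_ac del: binomial_Suc_Suc)
  qed
  also have "\<dots> = (\<Sum>k\<le>Suc n. const_poly (falling_ratio (Suc n) (Suc l) k) *
      (const_poly (real (Suc n choose k)) * u ^ k * v ^ (Suc n - k)))"
  proof -
    have "falling_ratio (Suc n) (Suc l) 0 = 0"
      unfolding falling_ratio_def prod.lessThan_Suc_shift by simp
    then show ?thesis unfolding sum.atMost_Suc_shift[of _ n] by simp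
  qed
  finally show ?case by (simp only: m)
qed

text \<open>Each of the \<open>l\<close> factors differs from \<open>k / m\<close> by at most \<open>l / (m - l)\<close>, and all numbers
  involved have modulus at most 1, so the error of the product is at most the sum of the errors.
  The hypothesis \<open>2 * l < m\<close> keeps the factors with \<open>k < j\<close> above \<open>-1\<close>.\<close>

lemma falling_ratio_bounds:
  assumes "k \<le> m" "2 * l < m"
  shows "\<bar>falling_ratio m l k\<bar> \<le> 1"
    and "\<bar>falling_ratio m l k - (real k / real m) ^ l\<bar> \<le> (real l)\<^sup>2 / (real m - real l)"
proof -
  have factor: "\<bar>(real k - real j) / (real m - real j)\<bar> \<le> 1" if "j < l" for j
    using that assms by (auto simp: abs_le_iff field_simps)
  show "\<bar>falling_ratio m l k\<bar> \<le> 1"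
    unfolding falling_ratio_def abs_prod by (rule prod_le_1) (use factor in auto)
  have diff: "\<bar>(real k - real j) / (real m - real j) - real k / real m\<bar> \<le> real l / (real m - real l)"
    if "j < l" for j
  proof -
    have pos: "real m - real j > 0" "real m > 0" "real m - real l > 0" using that assms by auto
    then have "(real k - real j) / (real m - real j) - real k / real m
      = - (real j * ((real m - real k) / real m) / (real m - real j))"
      by (simp add: field_simps)
    also have "\<bar>\<dots>\<bar> = real j * ((real m - real k) / real m) / (real m - real j)"
      using pos assms by simp
    also have "\<dots> \<le> real j * 1 / (real m - real j)"
      using pos assms by (intro divide_right_mono mult_left_mono) auto
    also have "\<dots> \<le> real l / (real m - real l)"
      using pos that by (intro frac_le) auto
    finally show ?thesis .
  qed
  have "\<bar>falling_ratio m l k - (real k / real m) ^ l\<bar>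
      = norm ((\<Prod>j<l. (real k - real j) / (real m - real j)) - (\<Prod>j<l. real k / real m))"
    by (simp add: falling_ratio_def)
  also have "\<dots> \<le> (\<Sum>j<l. norm ((real k - real j) / (real m - real j) - real k / real m))"
    by (rule norm_prod_diff) (use factor assms in auto)
  also have "\<dots> \<le> (\<Sum>j<l. real l / (real m - real l))"
    by (rule sum_mono) (use diff in auto)
  also have "\<dots> = (real l)\<^sup>2 / (real m - real l)"
    by (simp add: power2_eq_square)
  finally show "\<bar>falling_ratio m l k - (real k / real m) ^ l\<bar> \<le> (real l)\<^sup>2 / (real m - real l)" .
qed

text \<open>Affine coordinates \<open>u\<^sub>i = (R + x\<^sub>i) / 2R\<close> and \<open>v\<^sub>i = 1 - u\<^sub>i = (R - x\<^sub>i) / 2R\<close>, which map the box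
  \<open>[-R, R]\<^sup>d\<close> to the unit cube.\<close>

definition unit_var :: "real \<Rightarrow> 'd::finite \<Rightarrow> 'd mpoly" where
  "unit_var R i = const_poly (1 / (2 * R)) * (const_poly R + var_poly i)"

definition unit_covar :: "real \<Rightarrow> 'd::finite \<Rightarrow> 'd mpoly" where
  "unit_covar R i = const_poly (1 / (2 * R)) * (const_poly R + - var_poly i)"

definition bernstein :: "real \<Rightarrow> nat \<Rightarrow> ('d::finite \<Rightarrow> nat) \<Rightarrow> 'd mpoly" where
  "bernstein R m k =
     (\<Prod>i\<in>UNIV. const_poly (real (m choose k i)) * unit_var R i ^ k i * unit_covar R i ^ (m - k i))"

definition node :: "real \<Rightarrow> nat \<Rightarrow> ('d::finite \<Rightarrow> nat) \<Rightarrow> real ^ 'd" where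
  "node R m k = (\<chi> i. R * (2 * real (k i) / real m - 1))"

abbreviation grid :: "nat \<Rightarrow> ('d::finite \<Rightarrow> nat) set" where
  "grid m \<equiv> PiE UNIV (\<lambda>_. {..m})"

text \<open>The polynomial can be written in the Bernstein basis of every large degree with coefficients
  close to its values at the nodes. All polynomials have this property
  (\<open>bernstein_approx_all\<close>); phrasing it for a single polynomial allows a proof that starts from
  the monomials in the \<open>u\<^sub>i\<close> and uses closure under linear combinations only.\<close>

definition bernstein_approx :: "real \<Rightarrow> 'd::finite mpoly \<Rightarrow> bool" where
  "bernstein_approx R p \<longleftrightarrow> (\<forall>\<epsilon>>0. \<forall>\<^sub>F m in sequentially. \<exists>b.
     p = (\<Sum>k\<in>grid m. const_poly (b k) * bernstein R m k) \<and>
     (\<forall>k\<in>grid m. \<bar>b k - peval p (node R m k)\<bar> \<le> \<epsilon>))"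

lemma bernstein_approx_add:
  assumes "bernstein_approx R p" "bernstein_approx R q"
  shows "bernstein_approx R (p + q)"
  unfolding bernstein_approx_def
proof (intro allI impI)
  fix \<epsilon> :: real assume "\<epsilon> > 0"
  then have "\<epsilon> / 2 > 0" by simp
  have "\<forall>\<^sub>F m in sequentially. \<exists>b.
     p = (\<Sum>k\<in>grid m. const_poly (b k) * bernstein R m k) \<and>
     (\<forall>k\<in>grid m. \<bar>b k - peval p (node R m k)\<bar> \<le> \<epsilon> / 2)"
   "\<forall>\<^sub>F m in sequentially. \<exists>b.
     q = (\<Sum>k\<in>grid m. const_poly (b k) * bernstein R m k) \<and>
     (\<forall>k\<in>grid m. \<bar>b k - peval q (node R m k)\<bar> \<le> \<epsilon> / 2)"
    using assms \<open>\<epsilon> / 2 > 0\<close> unfolding bernstein_approx_def by blast+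
  then show "\<forall>\<^sub>F m in sequentially. \<exists>b.
     p + q = (\<Sum>k\<in>grid m. const_poly (b k) * bernstein R m k) \<and>
     (\<forall>k\<in>grid m. \<bar>b k - peval (p + q) (node R m k)\<bar> \<le> \<epsilon>)"
  proof eventually_elim
    case (elim m)
    then obtain b c where
      b: "p = (\<Sum>k\<in>grid m. const_poly (b k) * bernstein R m k)"
         "\<forall>k\<in>grid m. \<bar>b k - peval p (node R m k)\<bar> \<le> \<epsilon> / 2" and
      c: "q = (\<Sum>k\<in>grid m. const_poly (c k) * bernstein R m k)"
         "\<forall>k\<in>grid m. \<bar>c k - peval q (node R m k)\<bar> \<le> \<epsilon> / 2" by blast
    have "p + q = (\<Sum>k\<in>grid m. const_poly (b k + c k) * bernstein R m k)"
      by (subst b(1), subst c(1)) (simp add: const_poly_add distrib_right sum.distrib)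
    moreover have "\<bar>b k + c k - peval (p + q) (node R m k)\<bar> \<le> \<epsilon>" if "k \<in> grid m" for k
      using bspec[OF b(2) that] bspec[OF c(2) that] unfolding peval_add by linarith
    ultimately show ?case by (intro exI[of _ "\<lambda>k. b k + c k"]) blast
  qed
qed

lemma bernstein_approx_const_mult:
  assumes "bernstein_approx R p"
  shows "bernstein_approx R (const_poly a * p)"
  unfolding bernstein_approx_def
proof (intro allI impI)
  fix \<epsilon> :: real assume "\<epsilon> > 0"
  then have "\<epsilon> / (\<bar>a\<bar> + 1) > 0" by simp
  then have "\<forall>\<^sub>F m in sequentially. \<exists>b.
     p = (\<Sum>k\<in>grid m. const_poly (b k) * bernstein R m k) \<and>
     (\<forall>k\<in>grid m. \<bar>b k - peval p (node R m k)\<bar> \<le> \<epsilon> / (\<bar>a\<bar> + 1))"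
    using assms unfolding bernstein_approx_def by blast
  then show "\<forall>\<^sub>F m in sequentially. \<exists>b.
     const_poly a * p = (\<Sum>k\<in>grid m. const_poly (b k) * bernstein R m k) \<and>
     (\<forall>k\<in>grid m. \<bar>b k - peval (const_poly a * p) (node R m k)\<bar> \<le> \<epsilon>)"
  proof eventually_elim
    case (elim m)
    then obtain b where
      b: "p = (\<Sum>k\<in>grid m. const_poly (b k) * bernstein R m k)"
         "\<forall>k\<in>grid m. \<bar>b k - peval p (node R m k)\<bar> \<le> \<epsilon> / (\<bar>a\<bar> + 1)" by blast
    have "const_poly a * p = (\<Sum>k\<in>grid m. const_poly (a * b k) * bernstein R m k)"
      by (subst b(1)) (simp add: const_poly_mult sum_distrib_left mult.assoc)
    moreover have "\<bar>a * b k - peval (const_poly a * p) (node R m k)\<bar> \<le> \<epsilon>" if "k \<in> grid m" for k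
    proof -
      have "\<bar>a * b k - peval (const_poly a * p) (node R m k)\<bar> = \<bar>a\<bar> * \<bar>b k - peval p (node R m k)\<bar>"
        by (simp flip: abs_mult right_diff_distrib)
      also have "\<dots> \<le> (\<bar>a\<bar> + 1) * (\<epsilon> / (\<bar>a\<bar> + 1))"
        using bspec[OF b(2) that] by (intro mult_mono) auto
      finally show ?thesis by simp
    qed
    ultimately show ?case by (intro exI[of _ "\<lambda>k. a * b k"]) blast
  qed
qed

lemma bernstein_approx_unit_monomial:
  fixes l :: "'d::finite \<Rightarrow> nat"
  assumes "R > 0"
  shows "bernstein_approx R (\<Prod>i\<in>UNIV. unit_var R i ^ l i)"
  unfolding bernstein_approx_def
proof (intro allI impI)
  fix \<epsilon> :: real assume "\<epsilon> > 0"
  let ?p = "\<Prod>i\<in>UNIV. unit_var R i ^ l i"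
  have "(\<lambda>m. a / (real m - b)) \<longlonglongrightarrow> 0" for a b
    using filterlim_tendsto_add_at_top[OF tendsto_const[of "-b"] filterlim_real_sequentially]
    by (intro tendsto_divide_0[OF tendsto_const] filterlim_at_top_imp_at_infinity) simp
  then have "(\<lambda>m. \<Sum>i\<in>UNIV. (real (l i))\<^sup>2 / (real m - real (l i))) \<longlonglongrightarrow> (\<Sum>i\<in>(UNIV::'d set). 0)"
    by (intro tendsto_sum)
  then have small: "\<forall>\<^sub>F m in sequentially. (\<Sum>i\<in>UNIV. (real (l i))\<^sup>2 / (real m - real (l i))) < \<epsilon>"
    using order_tendstoD(2) \<open>\<epsilon> > 0\<close> by fastforce
  have large: "\<forall>\<^sub>F m in sequentially. m > 2 * (\<Sum>i\<in>UNIV. l i)"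
    by (rule eventually_gt_at_top)
  show "\<forall>\<^sub>F m in sequentially. \<exists>b.
     ?p = (\<Sum>k\<in>grid m. const_poly (b k) * bernstein R m k) \<and>
     (\<forall>k\<in>grid m. \<bar>b k - peval ?p (node R m k)\<bar> \<le> \<epsilon>)"
    using small large
  proof eventually_elim
    case (elim m)
    have "m > 0" using elim(2) by simp
    have l: "2 * l i < m" for i
      using elim(2) member_le_sum[of i UNIV l] by simp
    have uv: "unit_var R i + unit_covar R i = 1" for i :: 'd
      using assms unfolding unit_var_def unit_covar_def distrib_left[symmetric]
      by (simp flip: const_poly_add const_poly_mult add: algebra_simps)
    define b where "b k = (\<Prod>i\<in>UNIV. falling_ratio m (l i) (k i))" for k
    have "unit_var R i ^ l i = (\<Sum>k\<le>m. const_poly (falling_ratio m (l i) k) *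
        (const_poly (real (m choose k)) * unit_var R i ^ k * unit_covar R i ^ (m - k)))" for i
      using l[of i] by (intro power_bernstein_expansion uv) simp
    then have "?p = (\<Prod>i\<in>UNIV. \<Sum>k\<le>m. const_poly (falling_ratio m (l i) k) *
        (const_poly (real (m choose k)) * unit_var R i ^ k * unit_covar R i ^ (m - k)))" by (rule prod.cong[OF refl])
    also have "\<dots> = (\<Sum>k\<in>grid m. \<Prod>i\<in>UNIV. const_poly (falling_ratio m (l i) (k i)) *
        (const_poly (real (m choose k i)) * unit_var R i ^ k i * unit_covar R i ^ (m - k i)))"
      by (rule prod_sum_PiE) auto
    also have "\<dots> = (\<Sum>k\<in>grid m. const_poly (b k) * bernstein R m k)"
      by (simp add: b_def bernstein_def prod.distrib const_poly_prod)
    finally have 1: "?p = (\<Sum>k\<in>grid m. const_poly (b k) * bernstein R m k)" .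
    have 2: "\<bar>b k - peval ?p (node R m k)\<bar> \<le> \<epsilon>" if "k \<in> grid m" for k
    proof -
      have k: "k i \<le> m" for i using that by auto
      have "peval (unit_var R i) (node R m k) = real (k i) / real m" for i
        using assms l[of i] by (simp add: unit_var_def node_def field_simps)
      then have "\<bar>b k - peval ?p (node R m k)\<bar>
          = norm (b k - (\<Prod>i\<in>UNIV. (real (k i) / real m) ^ l i))"
        by (simp add: peval_prod)
      also have "\<dots> \<le> (\<Sum>i\<in>UNIV. norm (falling_ratio m (l i) (k i) - (real (k i) / real m) ^ l i))"
        unfolding b_def using falling_ratio_bounds(1)[OF k l] k l \<open>m > 0\<close>
        by (intro norm_prod_diff) (auto simp: power_abs intro!: power_le_one divide_le_eq_1_pos[THEN iffD2])
      also have "\<dots> \<le> (\<Sum>i\<in>UNIV. (real (l i))\<^sup>2 / (real m - real (l i)))"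
        using falling_ratio_bounds(2)[OF k l] by (intro sum_mono) simp
      finally show ?thesis using elim(1) by simp
    qed
    show ?case using 1 2 by blast
  qed
qed

lemma bernstein_approx_sum:
  assumes "R > 0" "\<And>i. i \<in> I \<Longrightarrow> bernstein_approx R (p i)"
  shows "bernstein_approx R (\<Sum>i\<in>I. p i)"
proof -
  have "bernstein_approx R (const_poly 0 * (\<Prod>i\<in>UNIV. unit_var R i ^ 0))"
    by (intro bernstein_approx_const_mult bernstein_approx_unit_monomial assms(1))
  then have "bernstein_approx R 0" by simp
  then show ?thesis using assms(2)
    by (induction I rule: infinite_finite_induct) (auto intro: bernstein_approx_add)
qed

text \<open>Substituting \<open>x\<^sub>i = 2 R u\<^sub>i - R\<close> and expanding binomially writes a monomial in the \<open>x\<^sub>i\<close> as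
  a linear combination of monomials in the \<open>u\<^sub>i\<close>.\<close>

lemma bernstein_approx_all:
  fixes p :: "'d::finite mpoly"
  assumes "R > 0"
  shows "bernstein_approx R p"
proof -
  let ?d = "\<lambda>n j. const_poly (real (n choose j) * (2 * R) ^ j * (- R) ^ (n - j)) :: 'd mpoly"
  have monomial: "bernstein_approx R (\<Prod>i\<in>UNIV. var_poly i ^ (l $ i))" for l :: "nat ^ 'd"
  proof -
    have "var_poly i = const_poly (2 * R) * unit_var R i + const_poly (- R)" for i :: 'd
      using assms unfolding unit_var_def mult.assoc[symmetric] const_poly_mult[symmetric]
      by (simp add: const_poly_uminus)
    then have "var_poly i ^ n = (\<Sum>j\<le>n. ?d n j * unit_var R i ^ j)" for i :: 'd and n
      by (simp add: binomial_ring const_poly_mult const_poly_power power_mult_distrib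
          mult_ac const_poly_of_nat del: const_poly_uminus)
    then have "(\<Prod>i\<in>UNIV. var_poly i ^ (l $ i)) =
        (\<Prod>i\<in>UNIV. \<Sum>j\<le>l $ i. ?d (l $ i) j * unit_var R i ^ j)"
      by simp
    also have "\<dots> = (\<Sum>k\<in>PiE UNIV (\<lambda>i. {..l $ i}). \<Prod>i\<in>UNIV. ?d (l $ i) (k i) * unit_var R i ^ k i)"
      by (rule prod_sum_PiE) auto
    also have "\<dots> = (\<Sum>k\<in>PiE UNIV (\<lambda>i. {..l $ i}).
       const_poly (\<Prod>i\<in>UNIV. real ((l $ i) choose (k i)) * (2 * R) ^ k i * (- R) ^ (l $ i - k i))
         * (\<Prod>i\<in>UNIV. unit_var R i ^ k i))"
      unfolding prod.distrib by (simp only: const_poly_prod const_poly_mult prod.distrib)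
    finally show ?thesis
      using assms by (auto intro!: bernstein_approx_sum bernstein_approx_const_mult
          bernstein_approx_unit_monomial)
  qed
  have "p = (\<Sum>l\<in>keys p. const_poly (lookup p l) * (\<Prod>i\<in>UNIV. var_poly i ^ (l $ i)))"
    using sum_single_superset[of "keys p" p] by (simp flip: single_eq_prod_var)
  moreover have "bernstein_approx R (\<Sum>l\<in>keys p. const_poly (lookup p l) * (\<Prod>i\<in>UNIV. var_poly i ^ (l $ i)))"
    by (intro bernstein_approx_sum bernstein_approx_const_mult monomial assms)
  ultimately show ?thesis by simp
qed

text \<open>Once the Bernstein coefficients are within the minimum of \<open>p\<close> on the box of its values at the
  nodes, they are nonnegative, and the Bernstein polynomials are products of elements of the
  preorder.\<close>

theorem positive_on_box_in_ball_preorder: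
  fixes p :: "'d::finite mpoly"
  assumes "R > 0" and pos: "\<And>x. (\<forall>i. \<bar>x $ i\<bar> \<le> R) \<Longrightarrow> peval p x > 0"
  shows "p \<in> ball_preorder (R\<^sup>2)"
proof -
  define B :: "(real ^ 'd) set" where "B = cbox (\<chi> i. - R) (\<chi> i. R)"
  have B: "x \<in> B \<longleftrightarrow> (\<forall>i. \<bar>x $ i\<bar> \<le> R)" for x
    unfolding B_def mem_box_cart by (auto simp: abs_le_iff minus_le_iff)
  have "0 \<in> B" using assms(1) by (simp add: B)
  then obtain z where z: "z \<in> B" "\<And>x. x \<in> B \<Longrightarrow> peval p z \<le> peval p x"
    using continuous_attains_inf[OF compact_cbox _ continuous_on_peval] unfolding B_def by blast
  have "peval p z > 0" using pos z(1) B by blast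
  then have "\<forall>\<^sub>F m in sequentially. \<exists>b.
     p = (\<Sum>k\<in>grid m. const_poly (b k) * bernstein R m k) \<and>
     (\<forall>k\<in>grid m. \<bar>b k - peval p (node R m k)\<bar> \<le> peval p z)"
    using bernstein_approx_all[OF assms(1)] unfolding bernstein_approx_def by blast
  then have "\<forall>\<^sub>F m in sequentially. m > 0 \<and> (\<exists>b.
     p = (\<Sum>k\<in>grid m. const_poly (b k) * bernstein R m k) \<and>
     (\<forall>k\<in>grid m. \<bar>b k - peval p (node R m k)\<bar> \<le> peval p z))"
    using eventually_gt_at_top by (rule eventually_conj[rotated])
  then obtain m b where m: "m > 0" and b: "p = (\<Sum>k\<in>grid m. const_poly (b k) * bernstein R m k)"
     "\<forall>k\<in>grid m. \<bar>b k - peval p (node R m k)\<bar> \<le> peval p z"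
    unfolding eventually_sequentially by blast
  have nonneg: "b k \<ge> 0" if "k \<in> grid m" for k
  proof -
    have "\<bar>node R m k $ i\<bar> \<le> R" for i
    proof -
      have "k i \<le> m" using that by auto
      then have "\<bar>2 * real (k i) / real m - 1\<bar> \<le> 1" using m by (auto simp: abs_le_iff field_simps)
      then have "R * \<bar>2 * real (k i) / real m - 1\<bar> \<le> R * 1"
        using assms(1) by (intro mult_left_mono) auto
      then show ?thesis using assms(1) by (simp add: node_def abs_mult)
    qed
    then have "peval p z \<le> peval p (node R m k)" using z(2) B by blast
    then show ?thesis using bspec[OF b(2) that] by linarith
  qed
  have "const_poly (1 / (2 * R)) * (const_poly R + s) \<in> ball_preorder (R\<^sup>2)"
    if "s = var_poly i \<or> s = - var_poly i" for i :: 'd and s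
    using assms(1) that by (intro ball_preorder_mult linear_in_ball_preorder[of R s i] ball_preorder_sos sos_const) auto
  then have "unit_var R i \<in> ball_preorder (R\<^sup>2)" "unit_covar R i \<in> ball_preorder (R\<^sup>2)" for i :: 'd
    unfolding unit_var_def unit_covar_def by blast+
  then have "bernstein R m k \<in> ball_preorder (R\<^sup>2)" for k :: "'d \<Rightarrow> nat"
    unfolding bernstein_def
    by (intro ball_preorder_prod ball_preorder_mult ball_preorder_power ball_preorder_sos[OF sos_const]) auto
  then show ?thesis
    by (subst b(1)) (intro ball_preorder_sum ball_preorder_mult ball_preorder_sos[OF sos_const] nonneg)
qed

section \<open>Putinar's Positivstellensatz\<close>

text \<open>Among the \<open>n + 1\<close> terms of the geometric sum \<open>g \<Sum>j\<le>n. (1 - g)\<^sup>j = 1 - (1 - g)\<^sup>n\<^sup>+\<^sup>1 \<le> 1\<close> the last is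
  the smallest.\<close>

lemma power_complement_mult_le:
  fixes g :: real
  assumes "0 \<le> g" "g \<le> 1"
  shows "(1 - g) ^ n * g \<le> 1 / real (Suc n)"
proof -
  have "real (Suc n) * ((1 - g) ^ n * g) = g * (\<Sum>j<Suc n. (1 - g) ^ n)"
    by simp
  also have "\<dots> \<le> g * (\<Sum>j<Suc n. (1 - g) ^ j)"
    using assms by (intro mult_left_mono sum_mono power_decreasing) auto
  also have "\<dots> = 1 - (1 - g) ^ Suc n"
    using one_diff_power_eq[of "1 - g" "Suc n"] by simp
  also have "\<dots> \<le> 1" using assms by simp
  finally show ?thesis by (simp add: field_simps)
qed

text \<open>The penalty is negligible where the constraint \<open>g \<ge> 0\<close> holds and at least as negative as \<open>g\<close>
  where it is violated.\<close>

lemma penalty_bound: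
  fixes g :: real
  assumes "g \<le> 1"
  shows "((1 - g) ^ k)\<^sup>2 * g \<le> 1 / real (Suc (2 * k)) - max 0 (- g)"
proof (cases "g \<ge> 0")
  case True
  then show ?thesis
    using power_complement_mult_le[OF True assms, of "2 * k"] by (simp flip: power_mult add: mult.commute)
next
  case False
  then have "((1 - g) ^ k)\<^sup>2 * g \<le> 1 * g"
    by (intro mult_right_mono_neg) (auto simp flip: power_mult intro!: one_le_power)
  also have "\<dots> \<le> 1 / real (Suc (2 * k)) - max 0 (- g)" using False by simp
  finally show ?thesis .
qed

text \<open>With the constraints scaled to be at most 1 on \<open>B\<close>, the sum \<open>V\<close> of the constraint violations is
  such that \<open>max 0 f + V\<close> is positive on \<open>B\<close>, hence at least some \<open>\<delta> > 0\<close> by compactness. Thus at each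
  point either \<open>f\<close> or \<open>V\<close> is at least \<open>\<delta> / 2\<close>. Subtracting \<open>c\<close> times the penalties adds
  at least \<open>c V\<close> up to an error of order \<open>c / k\<close>: where \<open>V\<close> is large, a large factor \<open>c\<close>
  outweighs any negative value of \<open>f\<close>; where \<open>f\<close> is large, only the error matters, and it is
  made small by choosing \<open>k\<close> after \<open>c\<close>.\<close>

lemma exists_positive_penalized:
  fixes B :: "(real ^ 'd::finite) set"
  assumes "compact B" "B \<noteq> {}" and pos: "\<And>x. x \<in> B \<inter> semialg_set H g \<Longrightarrow> peval f x > 0"
  obtains \<sigma> where "\<And>h. sos (\<sigma> h)" "\<And>x. x \<in> B \<Longrightarrow> peval (f - (\<Sum>h=1..H. \<sigma> h * g h)) x > 0"
proof -
  have "continuous_on B (\<lambda>x. \<Sum>h=1..H. \<bar>peval (g h) x\<bar>)" "continuous_on B (\<lambda>x. \<bar>peval f x\<bar>)"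
    by (intro continuous_intros continuous_on_peval)+
  from this[THEN continuous_attains_sup[OF assms(1,2)]] obtain y z where
    y: "\<And>x. x \<in> B \<Longrightarrow> (\<Sum>h=1..H. \<bar>peval (g h) x\<bar>) \<le> (\<Sum>h=1..H. \<bar>peval (g h) y\<bar>)" and
    z: "\<And>x. x \<in> B \<Longrightarrow> \<bar>peval f x\<bar> \<le> \<bar>peval f z\<bar>" by blast
  define M where "M = 1 + (\<Sum>h=1..H. \<bar>peval (g h) y\<bar>)"
  define N where "N = \<bar>peval f z\<bar>"
  have M: "M > 0" unfolding M_def by (intro add_pos_nonneg sum_nonneg) auto
  define G where "G h = const_poly (1 / M) * g h" for h
  have G: "peval (G h) x = peval (g h) x / M" for h x by (simp add: G_def)
  have G1: "peval (G h) x \<le> 1" if "x \<in> B" "h \<in> {1..H}" for h x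
  proof -
    have "\<bar>peval (g h) x\<bar> \<le> (\<Sum>h=1..H. \<bar>peval (g h) x\<bar>)"
      using that by (intro member_le_sum) auto
    also have "\<dots> \<le> M" using y[OF that(1)] by (simp add: M_def)
    finally show ?thesis using M by (simp add: G field_simps)
  qed
  define V where "V x = (\<Sum>h=1..H. max 0 (- peval (G h) x))" for x
  have V0: "V x \<ge> 0" for x unfolding V_def by (intro sum_nonneg) auto
  have "continuous_on B (\<lambda>x. max 0 (peval f x) + V x)"
    unfolding V_def by (intro continuous_intros continuous_on_peval)
  from continuous_attains_inf[OF assms(1,2) this] obtain w where
    w: "w \<in> B" "\<And>x. x \<in> B \<Longrightarrow> max 0 (peval f w) + V w \<le> max 0 (peval f x) + V x" by blast
  define \<delta> where "\<delta> = max 0 (peval f w) + V w"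
  have \<delta>: "\<delta> > 0"
  proof (cases "w \<in> semialg_set H g")
    case True
    then show ?thesis using pos[of w] w(1) V0[of w] by (simp add: \<delta>_def)
  next
    case False
    then obtain h where h: "h \<in> {1..H}" "peval (g h) w < 0" by (auto simp: semialg_set_def not_le)
    then have "0 < max 0 (- peval (G h) w)" using M by (simp add: G divide_less_0_iff less_max_iff_disj)
    also have "\<dots> \<le> V w" unfolding V_def using h(1) by (intro member_le_sum) auto
    finally show ?thesis unfolding \<delta>_def by (simp add: add_nonneg_pos)
  qed
  \<comment> \<open>chosen so that \<open>c * (\<delta> / 2)\<close> exceeds the bound \<open>N\<close> of \<open>\<bar>f\<bar>\<close> on \<open>B\<close> by more than the error \<open>\<delta> / 2\<close>\<close>
  define c where "c = 2 * (N + 1) / \<delta> + 1"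
  have c: "c > 0" "c * (\<delta> / 2) = N + 1 + \<delta> / 2"
    using \<delta> by (auto simp: c_def N_def field_simps add_pos_nonneg)
  obtain k :: nat where k: "c * real H / (\<delta> / 2) < real k"
    using reals_Archimedean2 by blast
  have kk: "c * (real H / real (Suc (2 * k))) < \<delta> / 2"
  proof -
    have "c * real H < real k * (\<delta> / 2)" using k \<delta> by (simp add: field_simps)
    also have "\<dots> \<le> real (Suc (2 * k)) * (\<delta> / 2)" using \<delta> by (intro mult_right_mono) auto
    finally show ?thesis by (simp add: field_simps)
  qed
  define \<sigma> where "\<sigma> h = const_poly (c / M) * ((1 - G h) ^ k)\<^sup>2" for h
  have "sos (\<sigma> h)" for h
    unfolding \<sigma>_def using c M by (intro sos_mult sos_const sos_square) simp
  moreover have "peval (f - (\<Sum>h=1..H. \<sigma> h * g h)) x > 0" if x: "x \<in> B" for x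
  proof -
    have "peval (\<Sum>h=1..H. \<sigma> h * g h) x = c * (\<Sum>h=1..H. ((1 - peval (G h) x) ^ k)\<^sup>2 * peval (G h) x)"
      by (simp add: peval_sum \<sigma>_def G sum_distrib_left mult.assoc)
    also have "\<dots> \<le> c * (\<Sum>h=1..H. 1 / real (Suc (2 * k)) - max 0 (- peval (G h) x))"
      using c(1) x by (intro mult_left_mono sum_mono penalty_bound G1) auto
    also have "\<dots> = c * (real H / real (Suc (2 * k))) - c * V x"
      by (simp add: V_def sum_subtractf right_diff_distrib)
    also have "\<dots> < \<delta> / 2 - c * V x" using kk by simp
    finally have less: "peval (\<Sum>h=1..H. \<sigma> h * g h) x < \<delta> / 2 - c * V x" .
    have "max 0 (peval f x) + V x \<ge> \<delta>" using w(2)[OF x] by (simp add: \<delta>_def)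
    then consider "peval f x \<ge> \<delta> / 2" | "V x \<ge> \<delta> / 2" using \<delta> by linarith
    then show ?thesis
    proof cases
      case 1
      moreover have "c * V x \<ge> 0" using c(1) V0[of x] by simp
      ultimately show ?thesis using less by simp
    next
      case 2
      then have "c * V x \<ge> c * (\<delta> / 2)" using c(1) by (intro mult_left_mono) auto
      moreover have "peval f x \<ge> - N" using z[OF x] by (simp add: N_def)
      ultimately show ?thesis using less c(2) by simp
    qed
  qed
  ultimately show ?thesis by (rule that)
qed

text \<open>The penalized polynomial is positive on a box around the ball given by the Archimedean
  condition, so it has a certificate built from \<open>C - \<parallel>x\<parallel>\<^sup>2\<close> alone; the Archimedean condition puts
  that polynomial, and hence its whole quadratic module, into the given one.\<close>

theorem putinar:
  fixes f :: "'d::finite mpoly"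
  assumes "archimedean H g" and pos: "\<And>x. x \<in> semialg_set H g \<Longrightarrow> peval f x > 0"
  shows "f \<in> qm H g"
proof -
  from assms(1) obtain C where C: "C > 0" "const_poly C - (\<Sum>i\<in>UNIV. (var_poly i)\<^sup>2) \<in> qm H g"
    unfolding archimedean_def qm_def by auto
  define R where "R = sqrt C"
  have R: "R > 0" "R\<^sup>2 = C" using C(1) by (auto simp: R_def)
  define B :: "(real ^ 'd) set" where "B = cbox (\<chi> i. - R) (\<chi> i. R)"
  have B: "x \<in> B \<longleftrightarrow> (\<forall>i. \<bar>x $ i\<bar> \<le> R)" for x
    unfolding B_def mem_box_cart by (auto simp: abs_le_iff minus_le_iff)
  have "0 \<in> B" using R by (simp add: B)
  then have "compact B" "B \<noteq> {}" by (auto simp: B_def compact_cbox)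
  then obtain \<sigma> where \<sigma>: "\<And>h. sos (\<sigma> h)" 
    "\<And>x. x \<in> B \<Longrightarrow> peval (f - (\<Sum>h=1..H. \<sigma> h * g h)) x > 0"
    using exists_positive_penalized[of B H g f] pos by blast
  have "f - (\<Sum>h=1..H. \<sigma> h * g h) \<in> ball_preorder (R\<^sup>2)"
    using R(1) \<sigma>(2) by (intro positive_on_box_in_ball_preorder) (auto simp: B)
  then have "f - (\<Sum>h=1..H. \<sigma> h * g h) \<in> qm H g"
    using ball_preorder_subset_qm[OF C(2)] by (auto simp: R)
  moreover have "(\<Sum>h=1..H. \<sigma> h * g h) \<in> qm H g"
    using qmI[of H "\<lambda>h. if h = 0 then 0 else \<sigma> h" g] \<sigma>(1) by simp
  ultimately show ?thesis using qm_add by fastforce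
qed

section \<open>Best approximation from finite-dimensional spaces\<close>

definition sup_norm :: "'x set \<Rightarrow> ('x \<Rightarrow> real) \<Rightarrow> real" where
  "sup_norm X F = (SUP x\<in>X. \<bar>F x\<bar>)"

definition bounded_fun :: "'x set \<Rightarrow> ('x \<Rightarrow> real) \<Rightarrow> bool" where
  "bounded_fun X F \<longleftrightarrow> (\<exists>K. \<forall>x\<in>X. \<bar>F x\<bar> \<le> K)"

lemma sup_norm_upper: "bounded_fun X F \<Longrightarrow> x \<in> X \<Longrightarrow> \<bar>F x\<bar> \<le> sup_norm X F"
  unfolding sup_norm_def bounded_fun_def by (intro cSUP_upper) (auto simp: bdd_above_def)

lemma sup_norm_least: "X \<noteq> {} \<Longrightarrow> (\<And>x. x \<in> X \<Longrightarrow> \<bar>F x\<bar> \<le> K) \<Longrightarrow> sup_norm X F \<le> K"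
  unfolding sup_norm_def by (rule cSUP_least)

lemma sup_norm_cong: "(\<And>x. x \<in> X \<Longrightarrow> F x = G x) \<Longrightarrow> sup_norm X F = sup_norm X G"
  unfolding sup_norm_def by simp

lemma bounded_fun_combination:
  assumes "bounded_fun X F" "bounded_fun X G"
  shows "bounded_fun X (\<lambda>x. F x - a * G x)"
proof -
  obtain K L where "\<forall>x\<in>X. \<bar>F x\<bar> \<le> K" "\<forall>x\<in>X. \<bar>G x\<bar> \<le> L"
    using assms unfolding bounded_fun_def by blast
  then have "\<bar>F x - a * G x\<bar> \<le> K + \<bar>a\<bar> * L" if "x \<in> X" for x
    using that abs_triangle_ineq4[of "F x" "a * G x"] mult_left_mono[of "\<bar>G x\<bar>" L "\<bar>a\<bar>"]
    by (fastforce simp: abs_mult)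
  then show ?thesis unfolding bounded_fun_def by blast
qed

lemma bounded_fun_sum:
  assumes "finite A" "\<And>i. i \<in> A \<Longrightarrow> bounded_fun X (\<phi> i)" "bounded_fun X F"
  shows "bounded_fun X (\<lambda>x. F x - (\<Sum>i\<in>A. c i * \<phi> i x))"
  using assms
proof (induction A rule: finite_induct)
  case (insert j A)
  have "bounded_fun X (\<lambda>x. (F x - (\<Sum>i\<in>A. c i * \<phi> i x)) - c j * \<phi> j x)"
    using insert by (intro bounded_fun_combination) auto
  then show ?case using insert by (simp add: algebra_simps)
qed simp

text \<open>Induction on the number of functions. If the new function \<open>\<phi> j\<close> has distance \<open>\<delta> = 0\<close> from the span of the
  others, it belongs to that span on \<open>X\<close>, because the distance is attained. Otherwise let \<open>D a\<close> be
  the distance of \<open>F - a \<phi> j\<close> from that span: \<open>D\<close> is Lipschitz and grows at least like \<open>\<delta> |a|\<close>, so it has a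
  minimum over the real line.\<close>

theorem best_approximation_exists:
  fixes \<phi> :: "'i \<Rightarrow> 'x \<Rightarrow> real"
  assumes "finite A" "X \<noteq> {}" "\<And>i. i \<in> A \<Longrightarrow> bounded_fun X (\<phi> i)" "bounded_fun X F"
  shows "\<exists>c. \<forall>c'. sup_norm X (\<lambda>x. F x - (\<Sum>i\<in>A. c i * \<phi> i x))
                \<le> sup_norm X (\<lambda>x. F x - (\<Sum>i\<in>A. c' i * \<phi> i x))"
  using assms(1,3,4)
proof (induction A arbitrary: F rule: finite_induct)
  case empty
  then show ?case by simp
next
  case (insert j A)
  define S where "S c x = (\<Sum>i\<in>A. c i * \<phi> i x)" for c x
  have bj: "bounded_fun X (\<phi> j)" and bA: "\<And>i. i \<in> A \<Longrightarrow> bounded_fun X (\<phi> i)"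
    using insert.prems by auto
  have IH: "\<exists>c. \<forall>c'. sup_norm X (\<lambda>x. G x - S c x) \<le> sup_norm X (\<lambda>x. G x - S c' x)"
    if "bounded_fun X G" for G
    unfolding S_def using bA that by (rule insert.IH)
  have bS: "bounded_fun X (\<lambda>x. G x - S c x)" if "bounded_fun X G" for G c
    unfolding S_def using insert.hyps bA that by (intro bounded_fun_sum)
  have split: "(\<Sum>i\<in>insert j A. c i * \<phi> i x) = c j * \<phi> j x + S c x" for c x
    using insert.hyps by (simp add: S_def)
  have S_upd: "S (c(j := a)) x = S c x" for c a x
    unfolding S_def using insert.hyps by (intro sum.cong) auto
  obtain e where e: "\<And>c'. sup_norm X (\<lambda>x. \<phi> j x - S e x) \<le> sup_norm X (\<lambda>x. \<phi> j x - S c' x)"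
    using IH[OF bj] by blast
  define \<delta> where "\<delta> = sup_norm X (\<lambda>x. \<phi> j x - S e x)"
  have ge0: "sup_norm X G \<ge> 0" if "bounded_fun X G" for G
    using assms(2) sup_norm_upper[OF that] abs_ge_zero order_trans by blast
  show ?case
  proof (cases "\<delta> = 0")
    case True
    have dep: "\<phi> j x = S e x" if "x \<in> X" for x
      using sup_norm_upper[OF bS[OF bj] that, of e] True by (simp add: \<delta>_def)
    obtain c where c: "\<And>c'. sup_norm X (\<lambda>x. F x - S c x) \<le> sup_norm X (\<lambda>x. F x - S c' x)"
      using IH[OF insert.prems(2)] by blast
    show ?thesis
    proof (intro exI allI)
      fix c'
      have "sup_norm X (\<lambda>x. F x - (\<Sum>i\<in>insert j A. (c(j := 0)) i * \<phi> i x)) = sup_norm X (\<lambda>x. F x - S c x)"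
        unfolding split S_upd by simp
      also have "\<dots> \<le> sup_norm X (\<lambda>x. F x - S (\<lambda>i. c' j * e i + c' i) x)" by (rule c)
      also have "\<dots> = sup_norm X (\<lambda>x. F x - (\<Sum>i\<in>insert j A. c' i * \<phi> i x))"
        unfolding split
        by (rule sup_norm_cong) (simp add: dep S_def algebra_simps sum.distrib sum_distrib_left)
      finally show "sup_norm X (\<lambda>x. F x - (\<Sum>i\<in>insert j A. (c(j := 0)) i * \<phi> i x))
        \<le> sup_norm X (\<lambda>x. F x - (\<Sum>i\<in>insert j A. c' i * \<phi> i x))" .
    qed
  next
    case False
    have \<delta>: "\<delta> > 0" using False ge0[OF bS[OF bj], of e] by (simp add: \<delta>_def)
    have "\<forall>a. \<exists>c. \<forall>c'. sup_norm X (\<lambda>x. (F x - a * \<phi> j x) - S c x) \<le> sup_norm X (\<lambda>x. (F x - a * \<phi> j x) - S c' x)"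
      using IH bounded_fun_combination[OF insert.prems(2) bj] by blast
    then obtain C where C: "\<And>a c'. sup_norm X (\<lambda>x. (F x - a * \<phi> j x) - S (C a) x)
          \<le> sup_norm X (\<lambda>x. (F x - a * \<phi> j x) - S c' x)" by metis
    define D where "D a = sup_norm X (\<lambda>x. (F x - a * \<phi> j x) - S (C a) x)" for a
    have bD: "bounded_fun X (\<lambda>x. (F x - a * \<phi> j x) - S c x)" for a c
      by (intro bS bounded_fun_combination insert.prems bj)
    have lip: "D a \<le> D b + \<bar>a - b\<bar> * sup_norm X (\<phi> j)" for a b
    proof -
      have "D a \<le> sup_norm X (\<lambda>x. (F x - a * \<phi> j x) - S (C b) x)"
        unfolding D_def by (rule C)
      also have "\<dots> \<le> D b + \<bar>a - b\<bar> * sup_norm X (\<phi> j)"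
      proof (rule sup_norm_least[OF assms(2)])
        fix x assume x: "x \<in> X"
        have "F x - a * \<phi> j x - S (C b) x = (F x - b * \<phi> j x - S (C b) x) - (a - b) * \<phi> j x"
          by (simp add: algebra_simps)
        also have "\<bar>\<dots>\<bar> \<le> \<bar>F x - b * \<phi> j x - S (C b) x\<bar> + \<bar>a - b\<bar> * \<bar>\<phi> j x\<bar>"
          unfolding abs_mult[symmetric] by (rule abs_triangle_ineq4)
        also have "\<dots> \<le> D b + \<bar>a - b\<bar> * sup_norm X (\<phi> j)"
          unfolding D_def using x
          by (intro add_mono mult_left_mono sup_norm_upper[OF bD] sup_norm_upper[OF bj]) auto
        finally show "\<bar>F x - a * \<phi> j x - S (C b) x\<bar> \<le> D b + \<bar>a - b\<bar> * sup_norm X (\<phi> j)" .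
      qed
      finally show ?thesis .
    qed
    have coercive: "\<bar>a\<bar> * \<delta> \<le> D a + sup_norm X F" for a
    proof (cases "a = 0")
      case True
      then show ?thesis using ge0[OF bD, of 0 "C 0"] ge0[OF insert.prems(2)] by (simp add: D_def)
    next
      case False
      have "\<bar>a\<bar> * \<delta> \<le> \<bar>a\<bar> * sup_norm X (\<lambda>x. \<phi> j x - S (\<lambda>i. - C a i / a) x)"
        unfolding \<delta>_def by (intro mult_left_mono e) auto
      also have "sup_norm X (\<lambda>x. \<phi> j x - S (\<lambda>i. - C a i / a) x) \<le> (D a + sup_norm X F) / \<bar>a\<bar>"
      proof (rule sup_norm_least[OF assms(2)])
        fix x assume x: "x \<in> X"
        have "S (\<lambda>i. - C a i / a) x = - (S (C a) x / a)"
          by (simp add: S_def sum_divide_distrib sum_negf)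
        then have "a * (\<phi> j x - S (\<lambda>i. - C a i / a) x) = F x - (F x - a * \<phi> j x - S (C a) x)"
          using False by (simp add: algebra_simps)
        then have "\<bar>a\<bar> * \<bar>\<phi> j x - S (\<lambda>i. - C a i / a) x\<bar> \<le> \<bar>F x\<bar> + \<bar>F x - a * \<phi> j x - S (C a) x\<bar>"
          unfolding abs_mult[symmetric] using abs_triangle_ineq4 by metis
        also have "\<dots> \<le> sup_norm X F + D a"
          unfolding D_def using x by (intro add_mono sup_norm_upper bD insert.prems) auto
        finally show "\<bar>\<phi> j x - S (\<lambda>i. - C a i / a) x\<bar> \<le> (D a + sup_norm X F) / \<bar>a\<bar>"
          using False by (simp add: field_simps)
      qed
      finally show ?thesis using False by (simp add: mult_left_mono)
    qed
    have "continuous_on UNIV D"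
    proof (rule lipschitz_on_continuous_on)
      show "(sup_norm X (\<phi> j))-lipschitz_on UNIV D"
      proof (rule lipschitz_onI)
        fix a b
        show "dist (D a) (D b) \<le> sup_norm X (\<phi> j) * dist a b"
          using lip[of a b] lip[of b a] by (simp add: dist_real_def abs_le_iff abs_minus_commute mult.commute)
      qed (rule ge0[OF bj])
    qed
    then have cont: "continuous_on {- r..r} D" for r
      by (rule continuous_on_subset) simp
    \<comment> \<open>beyond \<open>r\<close> coercivity forces \<open>D\<close> above \<open>sup_norm X F \<ge> D 0\<close>\<close>
    define r where "r = 2 * sup_norm X F / \<delta>"
    have "r \<ge> 0" using ge0[OF insert.prems(2)] \<delta> by (simp add: r_def)
    then obtain a0 where a0: "\<And>a. a \<in> {- r..r} \<Longrightarrow> D a0 \<le> D a"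
      using continuous_attains_inf[OF compact_Icc _ cont[of r]] by (metis atLeastatMost_empty_iff2 neg_le_0_iff_le order_trans)
    have D0: "D 0 \<le> sup_norm X F"
      unfolding D_def using C[of 0 "\<lambda>_. 0"] by (simp add: S_def)
    have a0_min: "D a0 \<le> D a" for a
    proof (cases "\<bar>a\<bar> \<le> r")
      case True
      then show ?thesis by (intro a0) auto
    next
      case False
      then have "r * \<delta> \<le> \<bar>a\<bar> * \<delta>" using \<delta> by (intro mult_right_mono) auto
      then have "2 * sup_norm X F \<le> D a + sup_norm X F"
        using coercive[of a] \<delta> by (simp add: r_def)
      then show ?thesis using D0 a0[of 0] \<open>r \<ge> 0\<close> by simp
    qed
    show ?thesis
    proof (intro exI allI)
      fix c'
      have "sup_norm X (\<lambda>x. F x - (\<Sum>i\<in>insert j A. ((C a0)(j := a0)) i * \<phi> i x)) = D a0"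
        unfolding split S_upd D_def by (simp add: diff_diff_eq)
      also have "\<dots> \<le> D (c' j)" by (rule a0_min)
      also have "\<dots> \<le> sup_norm X (\<lambda>x. (F x - c' j * \<phi> j x) - S c' x)"
        unfolding D_def by (rule C)
      also have "\<dots> = sup_norm X (\<lambda>x. F x - (\<Sum>i\<in>insert j A. c' i * \<phi> i x))"
        unfolding split by (simp add: diff_diff_eq)
      finally show "sup_norm X (\<lambda>x. F x - (\<Sum>i\<in>insert j A. ((C a0)(j := a0)) i * \<phi> i x))
        \<le> sup_norm X (\<lambda>x. F x - (\<Sum>i\<in>insert j A. c' i * \<phi> i x))" .
    qed
  qed
qed

section \<open>Finite-dimensional Hahn-Banach extension\<close>

text \<open>The value table \<open>y\<close> on the functions \<open>\<phi> i\<close> extends to a linear functional on their span that is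
  bounded by the supremum over \<open>X\<close>. Stated with arbitrary upper bounds \<open>b\<close>, the condition avoids
  suprema; it also implies that \<open>y\<close> respects all linear relations between the functions on \<open>X\<close>.\<close>

definition dominated :: "'x set \<Rightarrow> ('i \<Rightarrow> 'x \<Rightarrow> real) \<Rightarrow> 'i set \<Rightarrow> ('i \<Rightarrow> real) \<Rightarrow> bool" where
  "dominated X \<phi> A y \<longleftrightarrow>
     (\<forall>c b. (\<forall>x\<in>X. (\<Sum>i\<in>A. c i * \<phi> i x) \<le> b) \<longrightarrow> (\<Sum>i\<in>A. c i * y i) \<le> b)"

lemma dominatedD:
  "dominated X \<phi> A y \<Longrightarrow> (\<And>x. x \<in> X \<Longrightarrow> (\<Sum>i\<in>A. c i * \<phi> i x) \<le> b) \<Longrightarrow> (\<Sum>i\<in>A. c i * y i) \<le> b"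
  unfolding dominated_def by blast

text \<open>A value \<open>s\<close> for the new function must lie above all numbers \<open>T c - b\<close> with \<open>S c - \<phi> j \<le> b\<close> and below
  all numbers \<open>b - T c\<close> with \<open>S c + \<phi> j \<le> b\<close>. Adding two such inequalities eliminates
  \<open>\<phi> j\<close>, so domination on \<open>A\<close> makes every lower constraint at most every upper one, and
  the supremum of the lower ones works. Boundedness of \<open>\<phi> j\<close> makes both families nonempty.\<close>

lemma dominated_extend_one:
  assumes "finite A" "j \<notin> A" "bounded_fun X (\<phi> j)" "dominated X \<phi> A y"
  shows "\<exists>s. dominated X \<phi> (insert j A) (y(j := s))"
proof -
  define S where "S c x = (\<Sum>i\<in>A. c i * \<phi> i x)" for c x
  define T where "T c = (\<Sum>i\<in>A. c i * y i)" for c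
  define L where "L = {T c - b | c b. \<forall>x\<in>X. S c x - \<phi> j x \<le> b}"
  have dom: "T c \<le> b" if "\<And>x. x \<in> X \<Longrightarrow> S c x \<le> b" for c b
    using assms(4) that unfolding S_def T_def by (rule dominatedD)
  have scale: "S (\<lambda>i. a * c i) x = a * S c x" "T (\<lambda>i. a * c i) = a * T c" for a c x
    by (simp_all add: S_def T_def sum_distrib_left mult.assoc)
  have upper: "l \<le> b - T c" if "l \<in> L" and cb: "\<And>x. x \<in> X \<Longrightarrow> S c x + \<phi> j x \<le> b" for l c b
  proof -
    from that obtain c' b' where *: "l = T c' - b'" "\<And>x. x \<in> X \<Longrightarrow> S c' x - \<phi> j x \<le> b'"
      unfolding L_def by blast
    have "T (\<lambda>i. c i + c' i) \<le> b + b'"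
    proof (rule dom)
      fix x assume "x \<in> X"
      then show "S (\<lambda>i. c i + c' i) x \<le> b + b'"
        using cb[of x] *(2)[of x] by (simp add: S_def distrib_right sum.distrib)
    qed
    then show ?thesis by (simp add: *(1) T_def distrib_right sum.distrib)
  qed
  obtain K where K: "\<And>x. x \<in> X \<Longrightarrow> \<bar>\<phi> j x\<bar> \<le> K"
    using assms(3) unfolding bounded_fun_def by blast
  have "S (\<lambda>_. 0) x = 0" for x by (simp add: S_def)
  then have K': "S (\<lambda>_. 0) x - \<phi> j x \<le> K" "S (\<lambda>_. 0) x + \<phi> j x \<le> K" if "x \<in> X" for x
    using K[OF that] by (simp_all add: abs_le_iff)
  have "T (\<lambda>_. 0) - K \<in> L" unfolding L_def using K'(1) by blast
  then have ne: "L \<noteq> {}" by blast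
  have bdd: "bdd_above L" using upper[OF _ K'(2)] by (intro bdd_aboveI) blast
  define s where "s = Sup L"
  have "dominated X \<phi> (insert j A) (y(j := s))"
    unfolding dominated_def
  proof (intro allI impI)
    fix c b assume cb: "\<forall>x\<in>X. (\<Sum>i\<in>insert j A. c i * \<phi> i x) \<le> b"
    then have cb': "c j * \<phi> j x + S c x \<le> b" if "x \<in> X" for x
      using that assms(1,2) by (simp add: S_def)
    have "(\<Sum>i\<in>A. c i * (y(j := s)) i) = T c"
      unfolding T_def using assms(2) by (intro sum.cong) auto
    then have sum_eq: "(\<Sum>i\<in>insert j A. c i * (y(j := s)) i) = c j * s + T c"
      using assms(1,2) by simp
    consider "c j = 0" | "c j > 0" | "c j < 0" by linarith
    then have "c j * s + T c \<le> b"
    proof cases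
      case 1
      then show ?thesis using dom[of c b] cb' by simp
    next
      case 2
      have "s \<le> (1 / c j) * b - T (\<lambda>i. (1 / c j) * c i)"
        unfolding s_def
      proof (intro cSup_least[OF ne] upper)
        fix x assume "x \<in> X"
        then have "(1 / c j) * (c j * \<phi> j x + S c x) \<le> (1 / c j) * b"
          using 2 by (intro mult_left_mono cb') auto
        then show "S (\<lambda>i. (1 / c j) * c i) x + \<phi> j x \<le> (1 / c j) * b"
          using 2 unfolding scale distrib_left by (simp add: add.commute)
      qed
      then show ?thesis using 2 unfolding scale by (simp add: field_simps)
    next
      case 3
      have "T (\<lambda>i. (- 1 / c j) * c i) - (- 1 / c j) * b \<in> L"
      proof -
        have "S (\<lambda>i. (- 1 / c j) * c i) x - \<phi> j x \<le> (- 1 / c j) * b" if "x \<in> X" for x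
        proof -
          have "(- 1 / c j) * (c j * \<phi> j x + S c x) \<le> (- 1 / c j) * b"
            using 3 that by (intro mult_left_mono cb') auto
          then show ?thesis using 3 unfolding scale distrib_left by simp
        qed
        then show ?thesis unfolding L_def by blast
      qed
      then have "T (\<lambda>i. (- 1 / c j) * c i) - (- 1 / c j) * b \<le> s"
        unfolding s_def using bdd by (rule cSup_upper)
      then show ?thesis using 3 unfolding scale by (simp add: field_simps)
    qed
    then show "(\<Sum>i\<in>insert j A. c i * (y(j := s)) i) \<le> b" unfolding sum_eq .
  qed
  then show ?thesis ..
qed

theorem dominated_extension:
  assumes "finite B" "A \<subseteq> B" "\<And>i. i \<in> B \<Longrightarrow> bounded_fun X (\<phi> i)" "dominated X \<phi> A y"
  shows "\<exists>y'. (\<forall>i\<in>A. y' i = y i) \<and> dominated X \<phi> B y'"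
proof -
  have "finite A" using assms(1,2) finite_subset by blast
  have "finite C \<Longrightarrow> C \<subseteq> B \<Longrightarrow> C \<inter> A = {} \<Longrightarrow>
      \<exists>y'. (\<forall>i\<in>A. y' i = y i) \<and> dominated X \<phi> (A \<union> C) y'" for C
  proof (induction C rule: finite_induct)
    case empty
    then show ?case using assms(4) by auto
  next
    case (insert j C)
    then obtain y' where y': "\<forall>i\<in>A. y' i = y i" "dominated X \<phi> (A \<union> C) y'" by auto
    have "\<exists>s. dominated X \<phi> (insert j (A \<union> C)) (y'(j := s))"
      using insert \<open>finite A\<close> assms(3) y'(2) by (intro dominated_extend_one) auto
    then obtain s where "dominated X \<phi> (A \<union> insert j C) (y'(j := s))" by auto
    moreover have "\<forall>i\<in>A. (y'(j := s)) i = y i" using y'(1) insert.prems by auto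
    ultimately show ?case by blast
  qed
  moreover have "(B - A) \<inter> A = {}" by blast
  moreover have "A \<union> (B - A) = B" using assms(2) by blast
  ultimately show ?thesis
    using assms(1) by (metis Diff_subset finite_Diff)
qed

section \<open>Dual functionals for best approximation\<close>

text \<open>Names for the functions to which the extension theorem is applied. They live on two copies of
  \<open>\<Omega>\<close>, distinguished by a Boolean, so that one functional on this disjoint union is a pair
  \<open>(L\<^sup>+, L\<^sup>-)\<close>. \<open>Pos l\<close> and \<open>Neg l\<close> are the monomial \<open>x\<^sup>l\<close> on one copy and zero on the other; \<open>Gap l\<close> and
  \<open>Target\<close> carry the opposite signs on the two copies, so the functional takes the
  values \<open>L\<^sup>+ - L\<^sup>-\<close> on \<open>x\<^sup>l\<close> and on \<open>f\<close> there, which are prescribed to be 0 and \<open>E\<close>.\<close>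

datatype 'a gap_index = Gap 'a | Target | Pos 'a | Neg 'a

fun gap_fun :: "'d::finite mpoly \<Rightarrow> (nat ^ 'd) gap_index \<Rightarrow> (real ^ 'd) \<times> bool \<Rightarrow> real" where
  "gap_fun f (Gap l) (x, s) = (if s then monom_val l x else - monom_val l x)"
| "gap_fun f Target (x, s) = (if s then peval f x else - peval f x)"
| "gap_fun f (Pos l) (x, s) = (if s then monom_val l x else 0)"
| "gap_fun f (Neg l) (x, s) = (if s then 0 else monom_val l x)"

lemma peval_bounded_on_compact:
  assumes "compact \<Omega>"
  shows "bounded_fun \<Omega> (peval p)"
proof -
  have "bounded (peval p ` \<Omega>)"
    by (intro compact_imp_bounded compact_continuous_image continuous_on_peval assms)
  then show ?thesis unfolding bounded_fun_def bounded_iff by auto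
qed

lemma gap_fun_bounded:
  assumes "compact \<Omega>"
  shows "bounded_fun (\<Omega> \<times> UNIV) (gap_fun f i)"
proof -
  have m: "\<exists>K. \<forall>x\<in>\<Omega>. \<bar>monom_val l x\<bar> \<le> K" for l
    using peval_bounded_on_compact[OF assms, of "Poly_Mapping.single l 1"]
    unfolding bounded_fun_def peval_single by simp
  have f: "\<exists>K. \<forall>x\<in>\<Omega>. \<bar>peval f x\<bar> \<le> K"
    using peval_bounded_on_compact[OF assms, of f] unfolding bounded_fun_def .
  show ?thesis
  proof (cases i)
    case Target then show ?thesis using f unfolding bounded_fun_def by force
  next
    case (Gap l) then show ?thesis using m[of l] unfolding bounded_fun_def by force
  next
    case (Pos l)
    obtain K where "\<forall>x\<in>\<Omega>. \<bar>monom_val l x\<bar> \<le> K" using m by blast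
    then show ?thesis unfolding bounded_fun_def Pos by (intro exI[of _ "max K 0"]) (auto simp: le_max_iff_disj)
  next
    case (Neg l)
    obtain K where "\<forall>x\<in>\<Omega>. \<bar>monom_val l x\<bar> \<le> K" using m by blast
    then show ?thesis unfolding bounded_fun_def Neg by (intro exI[of _ "max K 0"]) (auto simp: le_max_iff_disj)
  qed
qed

lemma sum_gap_index:
  fixes F :: "'a gap_index \<Rightarrow> real"
  assumes "finite A" "finite B"
  shows "(\<Sum>i\<in>insert Target (Gap ` A \<union> Pos ` B \<union> Neg ` B). F i)
    = F Target + (\<Sum>l\<in>A. F (Gap l)) + (\<Sum>l\<in>B. F (Pos l)) + (\<Sum>l\<in>B. F (Neg l))"
proof -
  have "(\<Sum>i\<in>insert Target (Gap ` A \<union> Pos ` B \<union> Neg ` B). F i)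
      = F Target + (\<Sum>i\<in>Gap ` A \<union> Pos ` B \<union> Neg ` B. F i)"
    using assms by (subst sum.insert) auto
  also have "(\<Sum>i\<in>Gap ` A \<union> Pos ` B \<union> Neg ` B. F i)
      = (\<Sum>i\<in>Gap ` A. F i) + (\<Sum>i\<in>Pos ` B. F i) + (\<Sum>i\<in>Neg ` B. F i)"
    using assms by (subst sum.union_disjoint; (subst sum.union_disjoint)?) auto
  finally show ?thesis
    by (simp add: sum.reindex inj_on_def)
qed

lemma peval_monomials:
  assumes "tdeg p \<le> s"
  shows "peval p x = (\<Sum>l | mdeg l \<le> s. lookup p l * monom_val l x)"
  unfolding peval_riesz using assms by (intro riesz_superset) (auto simp: tdeg_le_iff)

lemma riesz_monomials:
  assumes "tdeg p \<le> s"
  shows "riesz y p = (\<Sum>l | mdeg l \<le> s. lookup p l * y l)"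
  using assms by (intro riesz_superset) (auto simp: tdeg_le_iff)

text \<open>On the span of the prescribed functions, domination by the supremum over both copies of \<open>\<Omega>\<close>
  says \<open>a E \<le> max |a f + q|\<close> for all \<open>q\<close> of degree at most \<open>m\<close>, which for \<open>a \<noteq> 0\<close> is the
  assumption that no such polynomial is closer to \<open>f\<close> than \<open>E\<close>. After extension to all monomials of
  degree at most \<open>s\<close>, domination yields every claim: a bound \<open>b = 0\<close> gives positivity, applying it
  to the two constants \<open>\<plusminus>1\<close> gives mass 1, and applying it with both signs to a combination that
  vanishes identically gives the equations.\<close>

theorem dual_functionals_exist:
  fixes \<Omega> :: "(real ^ 'd::finite) set"
  assumes "compact \<Omega>" "\<Omega> \<noteq> {}" "0 \<le> E" "m \<le> s" "tdeg f \<le> s"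
    and far: "\<And>p. tdeg p \<le> m \<Longrightarrow> \<exists>x\<in>\<Omega>. E \<le> \<bar>peval f x - peval p x\<bar>"
  obtains yp ym where
    "\<And>w. tdeg w \<le> s \<Longrightarrow> (\<And>x. x \<in> \<Omega> \<Longrightarrow> 0 \<le> peval w x) \<Longrightarrow> 0 \<le> riesz yp w"
    "\<And>w. tdeg w \<le> s \<Longrightarrow> (\<And>x. x \<in> \<Omega> \<Longrightarrow> 0 \<le> peval w x) \<Longrightarrow> 0 \<le> riesz ym w"
    "\<And>l. mdeg l \<le> m \<Longrightarrow> yp l = ym l" "yp 0 + ym 0 = 1" "riesz yp f - riesz ym f = E"
proof -
  define X where "X = \<Omega> \<times> (UNIV :: bool set)"
  define A where "A = insert Target (Gap ` {l :: nat ^ 'd. mdeg l \<le> m} \<union> Pos ` {} \<union> Neg ` {})"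
  define B where "B = insert Target (Gap ` {l :: nat ^ 'd. mdeg l \<le> m}
       \<union> Pos ` {l. mdeg l \<le> s} \<union> Neg ` {l. mdeg l \<le> s})"
  define y0 where "y0 i = (case i of Target \<Rightarrow> E | _ \<Rightarrow> 0)" for i :: "(nat ^ 'd) gap_index"
  have "dominated X (gap_fun f) A y0"
    unfolding dominated_def
  proof (intro allI impI)
    fix c b assume "\<forall>z\<in>X. (\<Sum>i\<in>A. c i * gap_fun f i z) \<le> b"
    then have le: "(\<Sum>i\<in>A. c i * gap_fun f i (x, s)) \<le> b" if "x \<in> \<Omega>" for x s
      using that by (auto simp: X_def)
    define q where "q = (\<Sum>l | mdeg l \<le> m. Poly_Mapping.single l (c (Gap l)))"
    have q: "peval q x = (\<Sum>l | mdeg l \<le> m. c (Gap l) * monom_val l x)" for x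
      by (simp add: q_def peval_sum peval_single)
    have "tdeg q \<le> m"
      unfolding tdeg_le_iff q_def using Poly_Mapping.keys_sum by (fastforce split: if_splits)
    have abs: "\<bar>c Target * peval f x + peval q x\<bar> \<le> b" if "x \<in> \<Omega>" for x
      using le[OF that, of True] le[OF that, of False]
      unfolding A_def sum_gap_index[OF finite_mdeg_le finite.emptyI]
      by (simp add: q sum_negf abs_le_iff)
    have "c Target * E \<le> b"
    proof (cases "c Target = 0")
      case True
      obtain x where "x \<in> \<Omega>" using assms(2) by blast
      from abs[OF this] True show ?thesis by simp
    next
      case False
      define p where "p = const_poly (- 1 / c Target) * q"
      have "tdeg p \<le> tdeg (const_poly (- 1 / c Target) :: 'd mpoly) + tdeg q"
        unfolding p_def by (rule tdeg_mult)
      also have "\<dots> \<le> m" using \<open>tdeg q \<le> m\<close> by simp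
      finally have "tdeg p \<le> m" .
      then obtain x where x: "x \<in> \<Omega>" "E \<le> \<bar>peval f x - peval p x\<bar>" using far by blast
      have "c Target * E \<le> \<bar>c Target\<bar> * E" using assms(3) by (intro mult_right_mono) auto
      also have "\<dots> \<le> \<bar>c Target\<bar> * \<bar>peval f x - peval p x\<bar>" using x(2) by (intro mult_left_mono) auto
      also have "\<dots> = \<bar>c Target * peval f x + peval q x\<bar>"
        using False unfolding abs_mult[symmetric] by (simp add: p_def algebra_simps)
      also have "\<dots> \<le> b" by (rule abs[OF x(1)])
      finally show ?thesis .
    qed
    then show "(\<Sum>i\<in>A. c i * y0 i) \<le> b"
      unfolding A_def sum_gap_index[OF finite_mdeg_le finite.emptyI] by (simp add: y0_def)
  qed
  moreover have "finite B" "A \<subseteq> B" by (auto simp: A_def B_def)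
  moreover have "bounded_fun X (gap_fun f i)" for i
    unfolding X_def by (rule gap_fun_bounded[OF assms(1)])
  ultimately obtain y where y: "\<And>i. i \<in> A \<Longrightarrow> y i = y0 i" "dominated X (gap_fun f) B y"
    using dominated_extension[of B A X "gap_fun f" y0] by blast
  have dom: "cT * E + (\<Sum>l | mdeg l \<le> s. cp l * y (Pos l)) + (\<Sum>l | mdeg l \<le> s. cm l * y (Neg l)) \<le> b"
    if pos: "\<And>x. x \<in> \<Omega> \<Longrightarrow> cT * peval f x + (\<Sum>l | mdeg l \<le> m. cg l * monom_val l x)
        + (\<Sum>l | mdeg l \<le> s. cp l * monom_val l x) \<le> b"
    and neg: "\<And>x. x \<in> \<Omega> \<Longrightarrow> - (cT * peval f x) - (\<Sum>l | mdeg l \<le> m. cg l * monom_val l x)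
        + (\<Sum>l | mdeg l \<le> s. cm l * monom_val l x) \<le> b"
    for cT b :: real and cg cp cm :: "nat ^ 'd \<Rightarrow> real"
  proof -
    define c where "c i = (case i of Target \<Rightarrow> cT | Gap l \<Rightarrow> cg l | Pos l \<Rightarrow> cp l | Neg l \<Rightarrow> cm l)" for i
    have c: "c Target = cT" "c (Gap l) = cg l" "c (Pos l) = cp l" "c (Neg l) = cm l" for l
      by (simp_all add: c_def)
    have "y Target = E" "\<And>l. mdeg l \<le> m \<Longrightarrow> y (Gap l) = 0"
      using y(1) by (simp_all add: A_def y0_def)
    then have "(\<Sum>i\<in>B. c i * y i) = cT * E + (\<Sum>l | mdeg l \<le> s. cp l * y (Pos l)) + (\<Sum>l | mdeg l \<le> s. cm l * y (Neg l))"
      by (simp add: B_def sum_gap_index c)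
    moreover have "(\<Sum>i\<in>B. c i * y i) \<le> b"
    proof (rule dominatedD[OF y(2)])
      fix z assume "z \<in> X"
      then obtain x s where z: "z = (x, s)" "x \<in> \<Omega>" by (auto simp: X_def)
      show "(\<Sum>i\<in>B. c i * gap_fun f i z) \<le> b"
        using pos[OF z(2)] neg[OF z(2)] unfolding z(1) B_def
        by (cases s) (simp_all add: sum_gap_index c sum_negf)
    qed
    ultimately show ?thesis by simp
  qed
  define yp where "yp l = y (Pos l)" for l
  define ym where "ym l = y (Neg l)" for l
  note dom = dom[folded yp_def ym_def]
  \<comment> \<open>domination with bound 0, for the negatives of functions that are nonnegative on both copies of \<open>\<Omega>\<close>\<close>
  have pair_nonneg: "0 \<le> a * E + riesz yp u + riesz ym v"
    if "tdeg u \<le> s" "tdeg v \<le> s" "tdeg q \<le> m"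
      "\<And>x. x \<in> \<Omega> \<Longrightarrow> 0 \<le> a * peval f x + peval q x + peval u x"
      "\<And>x. x \<in> \<Omega> \<Longrightarrow> 0 \<le> peval v x - a * peval f x - peval q x" for a u v q
  proof -
    have "(- a) * E + (\<Sum>l | mdeg l \<le> s. (- lookup u l) * yp l) + (\<Sum>l | mdeg l \<le> s. (- lookup v l) * ym l) \<le> 0"
    proof (rule dom[of "- a" "\<lambda>l. - lookup q l"])
      fix x assume "x \<in> \<Omega>"
      from that(4,5)[OF this]
      show "- a * peval f x + (\<Sum>l | mdeg l \<le> m. - lookup q l * monom_val l x)
        + (\<Sum>l | mdeg l \<le> s. - lookup u l * monom_val l x) \<le> 0"
       "- (- a * peval f x) - (\<Sum>l | mdeg l \<le> m. - lookup q l * monom_val l x)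
        + (\<Sum>l | mdeg l \<le> s. - lookup v l * monom_val l x) \<le> 0"
        unfolding peval_monomials[OF that(1)] peval_monomials[OF that(2)] peval_monomials[OF that(3)]
        by (simp_all add: sum_negf)
    qed
    then show ?thesis unfolding riesz_monomials[OF that(1)] riesz_monomials[OF that(2)]
      by (simp add: sum_negf)
  qed
  have tdeg_monomial: "tdeg (Poly_Mapping.single l a :: 'd mpoly) \<le> k" if "mdeg l \<le> k" for l a k
    using that by (simp add: tdeg_le_iff)
  have tdeg_0: "tdeg (0 :: 'd mpoly) \<le> k" for k by (simp add: tdeg_le_iff)
  have eq_gap: "a * E + riesz yp u + riesz ym v = 0"
    if "tdeg u \<le> s" "tdeg v \<le> s" "tdeg q \<le> m"
      "\<And>x. a * peval f x + peval q x + peval u x = 0"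
      "\<And>x. peval v x = a * peval f x + peval q x" for a u v q
  proof (rule antisym)
    have "0 \<le> (- a) * E + riesz yp (- u) + riesz ym (- v)"
    proof (rule pair_nonneg[where q = "- q"])
      fix x
      show "0 \<le> - a * peval f x + peval (- q) x + peval (- u) x"
        using that(4)[of x] by simp
      show "0 \<le> peval (- v) x - - a * peval f x - peval (- q) x"
        using that(5)[of x] by simp
    qed (use that in simp_all)
    then show "a * E + riesz yp u + riesz ym v \<le> 0" by (simp add: riesz_uminus)
    show "0 \<le> a * E + riesz yp u + riesz ym v"
      using that by (intro pair_nonneg[where q = q]) auto
  qed
  show thesis
  proof (rule that[of yp ym])
    fix w assume w: "tdeg w \<le> s" "\<And>x. x \<in> \<Omega> \<Longrightarrow> 0 \<le> peval w x"
    show "0 \<le> riesz yp w"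
      using pair_nonneg[of w 0 0 0] w tdeg_0 by simp
    show "0 \<le> riesz ym w"
      using pair_nonneg[of 0 w 0 0] w tdeg_0 by simp
  next
    fix l :: "nat ^ 'd" assume l: "mdeg l \<le> m"
    have "0 * E + riesz yp (Poly_Mapping.single l (- 1)) + riesz ym (Poly_Mapping.single l 1) = 0"
      using l assms(4)
      by (intro eq_gap[where q = "Poly_Mapping.single l 1"] tdeg_monomial) (auto simp: peval_single)
    then show "yp l = ym l" by simp
  next
    have one: "tdeg (Poly_Mapping.single (0 :: nat ^ 'd) a) \<le> s" for a :: real
      by (rule tdeg_monomial) simp
    have "(0::real) * E + (\<Sum>l | mdeg l \<le> s. lookup (Poly_Mapping.single 0 a) l * yp l)
        + (\<Sum>l | mdeg l \<le> s. lookup (Poly_Mapping.single 0 a) l * ym l) \<le> a" for a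
      by (rule dom[of 0 "\<lambda>_. 0"]) (simp_all add: peval_monomials[OF one, symmetric] peval_single)
    then have "a * yp 0 + a * ym 0 \<le> a" for a
      using riesz_monomials[OF one, of yp a] riesz_monomials[OF one, of ym a] by simp
    from this[of 1] this[of "- 1"] show "yp 0 + ym 0 = 1" by simp
  next
    have "1 * E + riesz yp (- f) + riesz ym f = 0"
      using assms(5) by (intro eq_gap[where q = 0] tdeg_0) auto
    then show "riesz yp f - riesz ym f = E" by (simp add: riesz_uminus)
  qed
qed

section \<open>Moment matrices and truncated certificates\<close>

lemma riesz_cong: "(\<And>l. l \<in> keys p \<Longrightarrow> y l = z l) \<Longrightarrow> riesz y p = riesz z p"
  unfolding riesz_def by (rule sum.cong) auto

lemma riesz_shift: "riesz (shift_seq g y) p = riesz y (p * g)"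
proof -
  have "riesz y (p * g) = (\<Sum>i\<in>keys p. \<Sum>j | mdeg j \<le> tdeg g. lookup p i * lookup g j * y (i + j))"
    by (rule riesz_mult) (auto simp: keys_subset_tdeg)
  then show ?thesis
    by (simp add: riesz_def shift_seq_def sum_distrib_left mult.assoc)
qed

text \<open>A vector indexed by the multi-indices of degree at most \<open>s\<close> is the coefficient vector of a polynomial
  of degree at most \<open>s\<close>.\<close>

lemma hankel_psd_iff: "hankel_psd s y \<longleftrightarrow> (\<forall>q. tdeg q \<le> s \<longrightarrow> 0 \<le> riesz y (q * q))"
  for y :: "nat ^ 'd::finite \<Rightarrow> real"
proof -
  let ?I = "{l :: nat ^ 'd. mdeg l \<le> s}"
  have form: "riesz y (q * q) = (\<Sum>i\<in>?I. \<Sum>j\<in>?I. lookup q i * hankel y i j * lookup q j)"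
    if "tdeg q \<le> s" for q :: "'d mpoly"
    using riesz_mult[of ?I q ?I q y] that by (simp add: tdeg_le_iff hankel_def mult_ac)
  show ?thesis
  proof
    assume "hankel_psd s y"
    then show "\<forall>q. tdeg q \<le> s \<longrightarrow> 0 \<le> riesz y (q * q)"
      by (simp add: hankel_psd_def psd_on_def form)
  next
    assume nonneg: "\<forall>q. tdeg q \<le> s \<longrightarrow> 0 \<le> riesz y (q * q)"
    have "0 \<le> (\<Sum>i\<in>?I. \<Sum>j\<in>?I. v i * hankel y i j * v j)" for v
    proof -
      define q where "q = (\<Sum>l\<in>?I. Poly_Mapping.single l (v l))"
      have q: "lookup q l = (if l \<in> ?I then v l else 0)" for l
        by (simp add: q_def lookup_sum lookup_single when_def)
      then have deg: "tdeg q \<le> s"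
        by (auto simp: tdeg_le_iff in_keys_iff split: if_splits)
      have "(\<Sum>i\<in>?I. \<Sum>j\<in>?I. v i * hankel y i j * v j) = riesz y (q * q)"
        unfolding form[OF deg] by (intro sum.cong) (auto simp: q)
      then show ?thesis using nonneg deg by simp
    qed
    then show "hankel_psd s y"
      by (simp add: hankel_psd_def psd_on_def hankel_def add.commute)
  qed
qed

text \<open>In this form the constraints say that \<open>riesz y\<close> is nonnegative on the generators of the
  truncated quadratic module, so truncation, monotonicity in \<open>t\<close> and weak duality become statements
  about degrees.\<close>

lemma psd_constraints_iff:
  "psd_constraints H g t y \<longleftrightarrow>
     (\<forall>q. tdeg q \<le> t \<longrightarrow> 0 \<le> riesz y (q * q)) \<and>
     (\<forall>h\<in>{1..H}. \<forall>q. tdeg q \<le> t - half_deg (g h) \<longrightarrow> 0 \<le> riesz y (q * q * g h))"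
  by (simp add: psd_constraints_def hankel_psd_iff riesz_shift)

lemma psd_constraints_antimono:
  assumes "s \<le> t" "psd_constraints H g t y" shows "psd_constraints H g s y"
  using assms unfolding psd_constraints_iff by (meson diff_le_mono order_trans)

lemma psd_constraints_cong:
  assumes "\<forall>h\<in>{1..H}. half_deg (g h) \<le> t" "\<And>l. mdeg l \<le> 2 * t \<Longrightarrow> y l = z l"
  shows "psd_constraints H g t y \<longleftrightarrow> psd_constraints H g t z"
proof -
  have cong: "riesz y p = riesz z p" if "tdeg p \<le> 2 * t" for p
    using that assms(2) by (intro riesz_cong) (auto simp: tdeg_le_iff)
  have "tdeg (q * q) \<le> 2 * t" if "tdeg q \<le> t" for q :: "'a mpoly"
    using tdeg_mult[of q q] that by simp
  moreover have "tdeg (q * q * g h) \<le> 2 * t" if "h \<in> {1..H}" "tdeg q \<le> t - half_deg (g h)" for q h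
    using tdeg_mult[of "q * q" "g h"] tdeg_mult[of q q] tdeg_le_half_deg[of "g h"] that assms(1)
    by fastforce
  ultimately show ?thesis unfolding psd_constraints_iff by (simp add: cong)
qed

lemma sos_mult_riesz_nonneg:
  assumes "sos \<sigma>"
  shows "\<forall>\<^sub>F t in sequentially. \<forall>y. (\<forall>q. tdeg q \<le> t - k \<longrightarrow> 0 \<le> riesz y (q * q * g)) \<longrightarrow> 0 \<le> riesz y (\<sigma> * g)"
proof -
  obtain n q where \<sigma>: "\<sigma> = (\<Sum>i<(n::nat). (q i)\<^sup>2)" using assms sos_def by metis
  have "\<forall>\<^sub>F t in sequentially. k + (\<Sum>i<n. tdeg (q i)) \<le> t" by (rule eventually_ge_at_top)
  then show ?thesis
  proof eventually_elim
    case (elim t)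
    have "tdeg (q i) \<le> t - k" if "i < n" for i
      using elim member_le_sum[of i "{..<n}" "\<lambda>i. tdeg (q i)"] that by simp
    then show ?case
      by (auto simp: \<sigma> sum_distrib_right riesz_sum power2_eq_square intro!: sum_nonneg)
  qed
qed

text \<open>For large \<open>t\<close> the degrees of the individual squares \<open>q\<^sup>2\<close> in the certificate are within the
  range of the positive semidefiniteness constraints.\<close>

lemma qm_eventually:
  assumes "w \<in> qm H g"
  shows "\<forall>\<^sub>F t in sequentially. w \<in> quad_module H g t \<and> (\<forall>y. psd_constraints H g t y \<longrightarrow> 0 \<le> riesz y w)"
proof -
  obtain \<sigma> where w: "w = \<sigma> 0 + (\<Sum>h=1..H. \<sigma> h * g h)" and \<sigma>: "\<forall>h\<in>{0..H}. sos (\<sigma> h)"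
    using assms unfolding qm_def by blast
  have "\<forall>\<^sub>F t in sequentially. tdeg (\<sigma> 0) + (\<Sum>h=1..H. tdeg (\<sigma> h * g h)) \<le> t"
    by (rule eventually_ge_at_top)
  moreover have "\<forall>\<^sub>F t in sequentially. \<forall>y. (\<forall>q. tdeg q \<le> t \<longrightarrow> 0 \<le> riesz y (q * q)) \<longrightarrow> 0 \<le> riesz y (\<sigma> 0)"
    using sos_mult_riesz_nonneg[of "\<sigma> 0" 0 1] \<sigma> by simp
  moreover have "\<forall>\<^sub>F t in sequentially. \<forall>h\<in>{1..H}. \<forall>y.
      (\<forall>q. tdeg q \<le> t - half_deg (g h) \<longrightarrow> 0 \<le> riesz y (q * q * g h)) \<longrightarrow> 0 \<le> riesz y (\<sigma> h * g h)"
    using \<sigma> by (intro eventually_ball_finite ballI sos_mult_riesz_nonneg) auto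
  ultimately show ?thesis
  proof eventually_elim
    case (elim t)
    have "tdeg (\<sigma> h * g h) \<le> 2 * t" if "h \<in> {1..H}" for h
      using elim(1) member_le_sum[of h "{1..H}" "\<lambda>h. tdeg (\<sigma> h * g h)"] that by simp
    moreover have "tdeg (\<sigma> 0) \<le> 2 * t" using elim(1) by simp
    ultimately have "w \<in> quad_module H g t" unfolding quad_module_def w using \<sigma> by blast
    moreover have "0 \<le> riesz y w" if y: "psd_constraints H g t y" for y
    proof -
      have "0 \<le> riesz y (\<sigma> 0)" using elim(2) y unfolding psd_constraints_iff by blast
      moreover have "0 \<le> riesz y (\<sigma> h * g h)" if "h \<in> {1..H}" for h
        using elim(3) y that unfolding psd_constraints_iff by blast
      ultimately show ?thesis
        unfolding w riesz_add riesz_sum by (intro add_nonneg_nonneg sum_nonneg) auto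
    qed
    ultimately show ?case by blast
  qed
qed

lemma quad_module_mono: "s \<le> t \<Longrightarrow> quad_module H g s \<subseteq> quad_module H g t"
  unfolding quad_module_def by fastforce

lemma quad_module_nonneg:
  assumes "w \<in> quad_module H g t" "x \<in> semialg_set H g"
  shows "0 \<le> peval w x"
proof -
  obtain \<sigma> where w: "w = \<sigma> 0 + (\<Sum>h=1..H. \<sigma> h * g h)" and \<sigma>: "\<forall>h\<in>{0..H}. sos (\<sigma> h)"
    using assms(1) unfolding quad_module_def by blast
  have "0 \<le> peval (\<sigma> h) x * peval (g h) x" if "h \<in> {1..H}" for h
    using \<sigma> that assms(2) by (intro mult_nonneg_nonneg[OF sos_nonneg]) (auto simp: semialg_set_def)
  then have "0 \<le> peval (\<Sum>h=1..H. \<sigma> h * g h) x"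
    unfolding peval_sum peval_mult by (intro sum_nonneg)
  then show ?thesis
    using sos_nonneg[of "\<sigma> 0" x] \<sigma> by (simp add: w)
qed

lemma max_dist_attained:
  assumes "compact \<Omega>" "\<Omega> \<noteq> {}"
  shows "\<exists>x\<in>\<Omega>. max_dist f p \<Omega> = \<bar>peval f x - peval p x\<bar>"
    and "x \<in> \<Omega> \<Longrightarrow> \<bar>peval f x - peval p x\<bar> \<le> max_dist f p \<Omega>"
proof -
  have "continuous_on \<Omega> (\<lambda>x. \<bar>peval f x - peval p x\<bar>)"
    by (intro continuous_intros continuous_on_peval)
  from continuous_attains_sup[OF assms this] obtain z where
    z: "z \<in> \<Omega>" "\<And>x. x \<in> \<Omega> \<Longrightarrow> \<bar>peval f x - peval p x\<bar> \<le> \<bar>peval f z - peval p z\<bar>" by blast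
  have "max_dist f p \<Omega> = \<bar>peval f z - peval p z\<bar>"
    unfolding max_dist_def using z by (intro Greatest_equality) auto
  with z show "\<exists>x\<in>\<Omega>. max_dist f p \<Omega> = \<bar>peval f x - peval p x\<bar>"
    "x \<in> \<Omega> \<Longrightarrow> \<bar>peval f x - peval p x\<bar> \<le> max_dist f p \<Omega>" by auto
qed

lemma best_approx_error_attained:
  fixes f :: "'d::finite mpoly"
  assumes "compact \<Omega>" "\<Omega> \<noteq> {}"
  shows "\<exists>p\<in>polys_upto m. max_dist f p \<Omega> = best_approx_error m f \<Omega>"
    and "q \<in> polys_upto m \<Longrightarrow> best_approx_error m f \<Omega> \<le> max_dist f q \<Omega>"
proof -
  let ?L = "{l :: nat ^ 'd. mdeg l \<le> m}"
  have "bounded_fun \<Omega> (monom_val l)" for l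
    using peval_bounded_on_compact[OF assms(1), of "Poly_Mapping.single l 1"]
    unfolding bounded_fun_def peval_single by simp
  then obtain c where c: "\<And>c'. sup_norm \<Omega> (\<lambda>x. peval f x - (\<Sum>l\<in>?L. c l * monom_val l x))
                \<le> sup_norm \<Omega> (\<lambda>x. peval f x - (\<Sum>l\<in>?L. c' l * monom_val l x))"
    using best_approximation_exists[of ?L \<Omega> monom_val "peval f"] assms peval_bounded_on_compact
    by fastforce
  define p where "p = (\<Sum>l\<in>?L. Poly_Mapping.single l (c l))"
  have p: "peval p x = (\<Sum>l\<in>?L. c l * monom_val l x)" for x
    by (simp add: p_def peval_sum peval_single)
  have "tdeg p \<le> m"
    unfolding tdeg_le_iff p_def using Poly_Mapping.keys_sum by (fastforce split: if_splits)
  have sup_norm: "sup_norm \<Omega> (\<lambda>x. peval f x - peval r x) = max_dist f r \<Omega>" for r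
  proof (rule antisym)
    show "sup_norm \<Omega> (\<lambda>x. peval f x - peval r x) \<le> max_dist f r \<Omega>"
      by (rule sup_norm_least[OF assms(2)]) (rule max_dist_attained[OF assms])
    have "bounded_fun \<Omega> (\<lambda>x. peval f x - peval r x)"
      using peval_bounded_on_compact[OF assms(1), of "f - r"] by (simp add: bounded_fun_def)
    then show "max_dist f r \<Omega> \<le> sup_norm \<Omega> (\<lambda>x. peval f x - peval r x)"
      using max_dist_attained(1)[OF assms, of f r] sup_norm_upper by fastforce
  qed
  have min: "max_dist f p \<Omega> \<le> max_dist f r \<Omega>" if "r \<in> polys_upto m" for r
    using c[of "lookup r"] that sup_norm[of r] sup_norm[of p]
    unfolding p polys_upto_def by (simp add: peval_monomials[of r m])
  have "best_approx_error m f \<Omega> = max_dist f p \<Omega>"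
    unfolding best_approx_error_def using min \<open>tdeg p \<le> m\<close>
    by (intro Least_equality) (auto simp: polys_upto_def)
  then show "\<exists>p\<in>polys_upto m. max_dist f p \<Omega> = best_approx_error m f \<Omega>"
    "q \<in> polys_upto m \<Longrightarrow> best_approx_error m f \<Omega> \<le> max_dist f q \<Omega>"
    using min \<open>tdeg p \<le> m\<close> by (auto simp: polys_upto_def)
qed

lemma ereal_tendsto_from_above:
  fixes u :: "nat \<Rightarrow> ereal"
  assumes "\<forall>\<^sub>F t in sequentially. ereal E \<le> u t"
    and "\<And>\<epsilon>. \<epsilon> > 0 \<Longrightarrow> \<forall>\<^sub>F t in sequentially. u t \<le> ereal (E + \<epsilon>)"
  shows "u \<longlonglongrightarrow> ereal E"
proof (rule order_tendstoI)
  fix a assume "a < ereal E"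
  show "\<forall>\<^sub>F t in sequentially. a < u t"
    using assms(1) by eventually_elim (rule less_le_trans[OF \<open>a < ereal E\<close>])
next
  fix a assume "ereal E < a"
  then obtain z where z: "ereal E < ereal z" "ereal z < a" using ereal_dense2 by blast
  then have "\<forall>\<^sub>F t in sequentially. u t \<le> ereal (E + (z - E))" by (intro assms(2)) simp
  then show "\<forall>\<^sub>F t in sequentially. u t < a"
    by eventually_elim (use z in auto)
qed

lemma ub_antimono: "s \<le> t \<Longrightarrow> ub H g n f t \<le> ub H g n f s"
  unfolding ub_def using quad_module_mono[of s t H g] by (intro Inf_superset_mono) blast

lemma best_approx_error_le_ub:
  assumes "\<Omega> = semialg_set H g" "compact \<Omega>" "\<Omega> \<noteq> {}"
  shows "ereal (best_approx_error (n - 1) f \<Omega>) \<le> ub H g n f t"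
  unfolding ub_def
proof (rule Inf_greatest, clarify)
  fix c p assume p: "p \<in> polys_upto (n - 1)" and
    c: "const_poly c + f - p \<in> quad_module H g t" "const_poly c - f + p \<in> quad_module H g t"
  obtain x where x: "x \<in> \<Omega>" "max_dist f p \<Omega> = \<bar>peval f x - peval p x\<bar>"
    using max_dist_attained(1)[OF assms(2,3)] by blast
  have "best_approx_error (n - 1) f \<Omega> \<le> max_dist f p \<Omega>"
    by (rule best_approx_error_attained(2)[OF assms(2,3) p])
  also have "\<dots> \<le> c"
    using c[THEN quad_module_nonneg] x assms(1) by (fastforce simp: abs_le_iff)
  finally show "ereal (best_approx_error (n - 1) f \<Omega>) \<le> ereal c" by simp
qed

lemma ub'_objective:
  "(\<Sum>l | mdeg l \<le> tdeg f. lookup f l * (yp l - ym l)) = riesz yp f - riesz ym f"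
  by (simp add: riesz_monomials[OF order_refl] sum_subtractf right_diff_distrib)

text \<open>Feasibility only concerns indices of degree at most \<open>2 t\<close>, so total sequences may be used
  in place of finite ones.\<close>

lemma feasible_le_ub':
  fixes f :: "'d::finite mpoly"
  assumes "\<forall>h\<in>{1..H}. half_deg (g h) \<le> t" "tdeg f \<le> t" "n - 1 \<le> t"
    and eq: "\<And>l. mdeg l \<le> n - 1 \<Longrightarrow> yp l = ym l" and one: "yp 0 + ym 0 = 1"
    and psd: "psd_constraints H g t yp" "psd_constraints H g t ym"
  shows "ereal (riesz yp f - riesz ym f) \<le> ub' H g n f t"
proof -
  define D where "D = {l :: nat ^ 'd. mdeg l \<le> 2 * t}"
  define zp where "zp = restrict yp D"
  define zm where "zm = restrict ym D"
  have z: "zp l = yp l" "zm l = ym l" if "mdeg l \<le> 2 * t" for l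
    using that by (simp_all add: zp_def zm_def D_def)
  have "riesz zp f = riesz yp f" "riesz zm f = riesz ym f"
    using assms(2) keys_subset_tdeg[of f] by (auto intro!: riesz_cong z)
  then have obj: "ereal (riesz yp f - riesz ym f)
      = ereal (\<Sum>l | mdeg l \<le> tdeg f. lookup f l * (zp l - zm l))"
    unfolding ub'_objective by simp
  have ext: "zp \<in> D \<rightarrow>\<^sub>E UNIV" "zm \<in> D \<rightarrow>\<^sub>E UNIV"
    by (simp_all add: zp_def zm_def)
  have eq': "\<forall>l. mdeg l \<le> n - 1 \<longrightarrow> zp l - zm l = 0"
    using assms(3) by (simp add: z eq)
  have one': "zp 0 + zm 0 = 1"
    using one by (simp add: z)
  have psd': "psd_constraints H g t zp" "psd_constraints H g t zm"
    using psd psd_constraints_cong[OF assms(1), of zp yp] psd_constraints_cong[OF assms(1), of zm ym] z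
    by blast+
  show ?thesis
    unfolding ub'_def D_def[symmetric]
    by (rule Sup_upper, rule CollectI, intro exI conjI) (rule obj ext eq' one' psd')+
qed

lemma ub'_antimono:
  fixes f :: "'d::finite mpoly"
  assumes "s \<le> t" "\<forall>h\<in>{1..H}. half_deg (g h) \<le> s" "tdeg f \<le> s" "n - 1 \<le> s"
  shows "ub' H g n f t \<le> ub' H g n f s"
  unfolding ub'_def[of H g n f t] ub'_objective
  using psd_constraints_antimono[OF assms(1)]
  by (intro Sup_least, clarify) (intro feasible_le_ub' assms(2-4); simp)

text \<open>The optimal functionals are nonnegative on \<open>q\<^sup>2\<close> and \<open>q\<^sup>2 g h\<close>, because these polynomials are
  nonnegative on \<open>\<Omega>\<close>.\<close>

lemma best_approx_error_le_ub':
  fixes f :: "'d::finite mpoly"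
  assumes "\<Omega> = semialg_set H g" "compact \<Omega>" "\<Omega> \<noteq> {}"
    and "\<forall>h\<in>{1..H}. half_deg (g h) \<le> t" "tdeg f \<le> t" "n - 1 \<le> t"
  shows "ereal (best_approx_error (n - 1) f \<Omega>) \<le> ub' H g n f t"
proof -
  let ?E = "best_approx_error (n - 1) f \<Omega>"
  have far: "\<exists>x\<in>\<Omega>. ?E \<le> \<bar>peval f x - peval p x\<bar>" if "tdeg p \<le> n - 1" for p
    using best_approx_error_attained(2)[OF assms(2,3), of p "n - 1" f] that
      max_dist_attained(1)[OF assms(2,3), of f p] by (auto simp: polys_upto_def)
  have "0 \<le> ?E"
    using best_approx_error_attained(1)[OF assms(2,3), of "n - 1" f] max_dist_attained(1)[OF assms(2,3), of f]
    by (metis abs_ge_zero)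
  then obtain yp ym where
    pos: "\<And>w. tdeg w \<le> 2 * t \<Longrightarrow> (\<And>x. x \<in> \<Omega> \<Longrightarrow> 0 \<le> peval w x) \<Longrightarrow> 0 \<le> riesz yp w"
      "\<And>w. tdeg w \<le> 2 * t \<Longrightarrow> (\<And>x. x \<in> \<Omega> \<Longrightarrow> 0 \<le> peval w x) \<Longrightarrow> 0 \<le> riesz ym w" and
    y: "\<And>l. mdeg l \<le> n - 1 \<Longrightarrow> yp l = ym l" "yp 0 + ym 0 = 1" "riesz yp f - riesz ym f = ?E"
    using dual_functionals_exist[OF assms(2,3), of ?E "n - 1" "2 * t" f] far assms(5,6) by auto
  have psd: "psd_constraints H g t y"
    if pos: "\<And>w. tdeg w \<le> 2 * t \<Longrightarrow> (\<And>x. x \<in> \<Omega> \<Longrightarrow> 0 \<le> peval w x) \<Longrightarrow> 0 \<le> riesz y w" for y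
    unfolding psd_constraints_iff
  proof (intro conjI ballI allI impI pos)
    fix q :: "'d mpoly" assume "tdeg q \<le> t"
    then show "tdeg (q * q) \<le> 2 * t" using tdeg_mult[of q q] by simp
  next
    fix h and q :: "'d mpoly" assume "h \<in> {1..H}" "tdeg q \<le> t - half_deg (g h)"
    then show "tdeg (q * q * g h) \<le> 2 * t"
      using tdeg_mult[of "q * q" "g h"] tdeg_mult[of q q] tdeg_le_half_deg[of "g h"] assms(4)
      by fastforce
  qed (use assms(1) in \<open>auto simp: semialg_set_def\<close>)
  have "psd_constraints H g t yp" "psd_constraints H g t ym"
    by (rule psd, rule pos; assumption)+
  from feasible_le_ub'[OF assms(4-6) y(1,2) this] y(3) show ?thesis by simp
qed

text \<open>Weak duality: apply \<open>L\<^sup>-\<close> to \<open>c + f - p\<close> and \<open>L\<^sup>+\<close> to \<open>c - f + p\<close> and add; the polynomial \<open>p\<close> cancels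
  since the two functionals agree on its monomials.\<close>

lemma ub'_le_of_certificate:
  assumes "tdeg p \<le> n - 1"
    and "\<And>y. psd_constraints H g t y \<Longrightarrow> 0 \<le> riesz y (const_poly c + f - p)"
    and "\<And>y. psd_constraints H g t y \<Longrightarrow> 0 \<le> riesz y (const_poly c - f + p)"
  shows "ub' H g n f t \<le> ereal c"
  unfolding ub'_def
proof (rule Sup_least, clarify)
  fix yp ym
  assume y: "\<forall>l. mdeg l \<le> n - 1 \<longrightarrow> yp l - ym l = 0" "yp 0 + ym 0 = 1"
    "psd_constraints H g t yp" "psd_constraints H g t ym"
  have "riesz yp p = riesz ym p"
    using y(1) assms(1) by (intro riesz_cong) (auto simp: tdeg_le_iff)
  moreover have "0 \<le> c * yp 0 - riesz yp f + riesz yp p" "0 \<le> c * ym 0 + riesz ym f - riesz ym p"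
    using assms(3)[OF y(3)] assms(2)[OF y(4)] by (simp_all add: riesz_add riesz_diff const_poly_def)
  moreover have "c * yp 0 + c * ym 0 = c" using y(2) by (simp flip: distrib_left)
  ultimately have "riesz yp f - riesz ym f \<le> c" by simp
  then show "ereal (\<Sum>l | mdeg l \<le> tdeg f. lookup f l * (yp l - ym l)) \<le> ereal c"
    unfolding ub'_objective by simp
qed

theorem theorem9:
  fixes g :: "nat \<Rightarrow> 'd::finite mpoly" and f :: "'d mpoly"
    and H n N t0 :: nat and \<Omega> :: "(real ^ 'd) set" and E :: real
  assumes "n \<ge> 1"
    and "\<Omega> = semialg_set H g"
    and "compact \<Omega>"
    and "interior \<Omega> \<noteq> {}"
    and "archimedean H g"
    and "tdeg f = N"
    and "N \<ge> n"
    and "t0 = N + Max ((\<lambda>h. half_deg (g h)) ` {1..H})"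
    and "E = best_approx_error (n - 1) f \<Omega>"
  shows "(\<forall>t\<ge>t0. ereal E \<le> ub H g n f t) \<and>
    (\<forall>t\<ge>t0. ereal E \<le> ub' H g n f t) \<and>
    antimono_on {t0..} (ub H g n f) \<and>
    antimono_on {t0..} (ub' H g n f) \<and>
    (\<lambda>t. ub H g n f t) \<longlonglongrightarrow> ereal E \<and>
    (\<lambda>t. ub' H g n f t) \<longlonglongrightarrow> ereal E"
proof -
  have ne: "\<Omega> \<noteq> {}" using assms(4) interior_subset by auto
  have large: "\<forall>h\<in>{1..H}. half_deg (g h) \<le> t" "tdeg f \<le> t" "n - 1 \<le> t" if "t \<ge> t0" for t
  proof -
    show "\<forall>h\<in>{1..H}. half_deg (g h) \<le> t"
    proof
      fix h assume "h \<in> {1..H}"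
      then have "half_deg (g h) \<le> Max ((\<lambda>h. half_deg (g h)) ` {1..H})" by (intro Max_ge) auto
      then show "half_deg (g h) \<le> t" using \<open>t \<ge> t0\<close> assms(8) by linarith
    qed
    show "tdeg f \<le> t" "n - 1 \<le> t" using \<open>t \<ge> t0\<close> assms(6,7,8) by auto
  qed
  have lower: "ereal E \<le> ub H g n f t" for t
    unfolding assms(9) by (rule best_approx_error_le_ub[OF assms(2,3) ne])
  have lower': "ereal E \<le> ub' H g n f t" if "t \<ge> t0" for t
    unfolding assms(9) by (rule best_approx_error_le_ub'[OF assms(2,3) ne large[OF that]])
  have "\<forall>\<^sub>F t in sequentially. ub H g n f t \<le> ereal (E + \<epsilon>) \<and> ub' H g n f t \<le> ereal (E + \<epsilon>)"
    if "\<epsilon> > 0" for \<epsilon>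
  proof -
    obtain p where p: "p \<in> polys_upto (n - 1)" "max_dist f p \<Omega> = E"
      using best_approx_error_attained(1)[OF assms(3) ne] assms(9) by blast
    have close: "\<bar>peval f x - peval p x\<bar> \<le> E" if "x \<in> \<Omega>" for x
      using max_dist_attained(2)[OF assms(3) ne that, of f p] p(2) by simp
    have pos: "0 < peval (const_poly (E + \<epsilon>) + f - p) x" "0 < peval (const_poly (E + \<epsilon>) - f + p) x"
      if "x \<in> semialg_set H g" for x
      using close[of x] that \<open>\<epsilon> > 0\<close> assms(2) by (auto simp: abs_le_iff)
    have "const_poly (E + \<epsilon>) + f - p \<in> qm H g" "const_poly (E + \<epsilon>) - f + p \<in> qm H g"
      by (intro putinar[OF assms(5)] pos; assumption)+
    from this[THEN qm_eventually] show ?thesis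
    proof eventually_elim
      case (elim t)
      have "ub H g n f t \<le> ereal (E + \<epsilon>)"
        unfolding ub_def using elim p(1) by (intro Inf_lower) blast
      moreover have "ub' H g n f t \<le> ereal (E + \<epsilon>)"
        using elim p(1) by (intro ub'_le_of_certificate[of p]) (auto simp: polys_upto_def)
      ultimately show ?case by blast
    qed
  qed
  note upper = this[THEN eventually_mono, OF _ conjunct1] this[THEN eventually_mono, OF _ conjunct2]
  have "(\<lambda>t. ub H g n f t) \<longlonglongrightarrow> ereal E"
    using lower upper(1) by (intro ereal_tendsto_from_above) auto
  moreover have "(\<lambda>t. ub' H g n f t) \<longlonglongrightarrow> ereal E"
    using lower' upper(2) by (intro ereal_tendsto_from_above) (auto simp: eventually_sequentially)
  moreover have "antimono_on {t0..} (ub H g n f)"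
    by (intro monotone_onI ub_antimono)
  moreover have "antimono_on {t0..} (ub' H g n f)"
    using large by (intro monotone_onI ub'_antimono) auto
  ultimately show ?thesis using lower lower' by blast
qed

end
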